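(* Consider the model $X_i=\mu\Delta+\beta\tau_i+\tau_i^{1/2}\epsilon_i$, $i=1,\dots,n$, where $(\tau_1,\ldots,\tau_n)$ are the actual variances of an integrated OU process driven by a subordinator $Z$ with Lévy exponent $\psi$, with stationary $v(0)$. Let $a=\lambda\Delta$. Then the marginal likelihood is $$\mathscr L(\mathbf X|\vartheta)=\frac{e^{n\bar A\beta}}{\pi^n}\int_{\mathbb R_+^n}\mathsf L_1(\mathbf y|\vartheta)\,\prod_{i=1}^n\cos(y_i|A_i|)\prod_{i=1}^ndy_i,$$ where $\omega_i=y_i^2/2+\beta^2/2$, $v_i=r_is_{i+1}$ with $r_i=e^{\lambda i\Delta}$ and $s_l=(1-e^{-\lambda\Delta})\left[\sum_{i=l}^n\omega_ie^{-\lambda(i-1)\Delta}\right]$ for $l=1,\dots,n$, and $\mathsf L_1(\mathbf y|\vartheta)$ is the joint Laplace transform of $(\tau_1,\dots,\tau_n)$ evaluated at $(\omega_1,\dots,\omega_n)$, which has the form $$\mathsf L_1(\mathbf y|\vartheta)=e^{-\varphi(s_1)}e^{-\Phi(\omega_n)}\prod_{i=1}^{n-1}e^{-\Phi(\omega_i|v_i)},$$ with (i) $\Phi(\omega_i|v_i)=\int_{e^{-a}}^1\psi\left(\lambda^{-1}[v_iu+\omega_i(1-u)]\right)\frac{du}u$ for $i=1,\dots,n-1$; (ii) $\Phi(\omega_n)=\int_{e^{-a}}^1\psi\left(\lambda^{-1}\omega_n(1-u)\right)\frac{du}u$; (iii) $\varphi(s_1)=\int_0^1\psi(s_1\lambda^{-1}u)\frac{du}u$,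 the Lévy exponent of $v(0)$ evaluated at $s_1\lambda^{-1}$.
   Context: $\lambda,\Delta>0$, $\mu,\beta\in\mathbb R$; $\epsilon_i$ iid standard Normal independent of $(\tau_i)$; $A_i=X_i-\mu\Delta$, $\bar A=n^{-1}\sum A_i$; $\vartheta$ denotes all parameters. The likelihood is $\mathscr L(\mathbf X|\vartheta)=E[\prod_{i}\phi(X_i|\mu\Delta+\beta\tau_i,\tau_i)]$ with data held fixed, where $\phi(x|m,\sigma^2)$ is the Normal density with mean $m$ and variance $\sigma^2$. $Z$ is a subordinator with $E[e^{-\omega Z(t)}]=e^{-t\psi(\omega)}$, $\psi(\omega)=\int_0^\infty(1-e^{-s\omega})\rho(ds)$. The OU process is $v(t)=e^{-\lambda t}v(0)+e^{-\lambda t}\int_0^te^{\lambda y}Z(d\lambda y)$, with $v(0)$ independent of $Z$ and, in the stationary case, with Lévy exponent $-\log E[e^{-\omega v(0)}]=\int_0^1\psi(\omega u)u^{-1}du$. (Here $\int_s^{t} g(y)Z(d\lambda y):=\int_{\lambda s}^{\lambda t}g(r/\lambda)Z(dr)$.) $\tau_i=\int_{(i-1)\Delta}^{i\Delta}v(s)ds$, so that $$\lambda\tau_i=(1-e^{-\lambda\Delta})v((i-1)\Delta)+\int_{(i-1)\Delta}^{i\Delta}(1-e^{-\lambda(i\Delta-y)})Z(d\lambda y).$$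
   Formalization: The integral over R_+^n need not converge absolutely; the likelihood formula is stated when the integrand is Lebesgue integrable, and otherwise as a limit over cubes [0,R]^n, assuming all A_i are nonzero and Z is not identically zero. *)

theory Defs
  imports "HOL-Probability.Probability"
begin

section \<open>Subordinators\<close>

text \<open>Jump measures of driftless subordinators, encoded as measures on the real line without mass
  on the nonpositive half-line.\<close>

definition subordinator_levy_measure :: "real measure \<Rightarrow> bool" where
  "subordinator_levy_measure \<rho> \<longleftrightarrow>
     sets \<rho> = sets borel \<and> emeasure \<rho> {..0} = 0 \<and> integrable \<rho> (\<lambda>s. min 1 s)"

definition levy_psi :: "real measure \<Rightarrow> real \<Rightarrow> real" where
  "levy_psi \<rho> \<theta> = (LINT s:{0<..}|\<rho>. 1 - exp (- (s * \<theta>)))"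

text \<open>The time parameter ranges over the nonnegative reals; values of \<open>Z\<close> at negative times are never
  used. Path properties are required for every sample point, so that the pathwise integrals
  below are meaningful everywhere.\<close>

definition subordinator :: "'w measure \<Rightarrow> (real \<Rightarrow> 'w \<Rightarrow> real) \<Rightarrow> real measure \<Rightarrow> bool" where
  "subordinator M Z \<rho> \<longleftrightarrow>
     prob_space M \<and> subordinator_levy_measure \<rho> \<and>
     (\<forall>t\<ge>0. Z t \<in> borel_measurable M) \<and>
     (\<forall>w\<in>space M. Z 0 w = 0 \<and> mono_on {0..} (\<lambda>t. Z t w) \<and>
        (\<forall>t\<ge>0. continuous (at_right t) (\<lambda>r. Z r w))) \<and>
     (\<forall>(t :: nat \<Rightarrow> real) k. 0 \<le> t 0 \<and> incseq t \<longrightarrow>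
        prob_space.indep_vars M (\<lambda>_. borel) (\<lambda>i w. Z (t (Suc i)) w - Z (t i) w) {..<k}) \<and>
     (\<forall>s t. 0 \<le> s \<and> s \<le> t \<longrightarrow>
        distr M borel (\<lambda>w. Z t w - Z s w) = distr M borel (Z (t - s))) \<and>
     (\<forall>t\<ge>0. \<forall>\<theta>\<ge>0. (LINT w|M. exp (- (\<theta> * Z t w))) = exp (- (t * levy_psi \<rho> \<theta>)))"

text \<open>Pathwise Lebesgue--Stieltjes integral of \<open>g y\<close> against \<open>Z (d lam y)\<close> over \<open>y\<close> between \<open>s\<close> and \<open>t\<close>.
  The path is extended by its initial value to negative times because \<^const>\<open>interval_measure\<close>
  expects a function on the whole line; the integration interval is half-open on the left, so a
  point at \<open>lam * s\<close> does not count.\<close>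

definition sub_integral ::
  "(real \<Rightarrow> 'w \<Rightarrow> real) \<Rightarrow> real \<Rightarrow> (real \<Rightarrow> real) \<Rightarrow> real \<Rightarrow> real \<Rightarrow> 'w \<Rightarrow> real" where
  "sub_integral Z lam g s t w =
     (LINT r:{lam * s<..lam * t}|interval_measure (\<lambda>x. Z (max 0 x) w). g (r / lam))"

section \<open>The stationary Ornstein--Uhlenbeck process and its integrated version\<close>

definition ou_process ::
  "(real \<Rightarrow> 'w \<Rightarrow> real) \<Rightarrow> ('w \<Rightarrow> real) \<Rightarrow> real \<Rightarrow> real \<Rightarrow> 'w \<Rightarrow> real" where
  "ou_process Z v0 lam t w =
     exp (- lam * t) * v0 w + exp (- lam * t) * sub_integral Z lam (\<lambda>y. exp (lam * y)) 0 t w"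

definition actual_variance ::
  "(real \<Rightarrow> 'w \<Rightarrow> real) \<Rightarrow> ('w \<Rightarrow> real) \<Rightarrow> real \<Rightarrow> real \<Rightarrow> nat \<Rightarrow> 'w \<Rightarrow> real" where
  "actual_variance Z v0 lam \<Delta> i w =
     (LINT s:{(real i - 1) * \<Delta>..real i * \<Delta>}|lborel. ou_process Z v0 lam s w)"

definition levy_exponent :: "'w measure \<Rightarrow> ('w \<Rightarrow> real) \<Rightarrow> real \<Rightarrow> real" where
  "levy_exponent M V \<theta> = - ln (LINT w|M. exp (- (\<theta> * V w)))"

text \<open>Integrability of \<open>\<psi> (\<theta> * u) / u\<close> near zero is the usual logarithmic moment condition on \<open>\<rho>\<close>, without
  which no stationary law exists. It has to be stated because the value of a non-integrable Bochner
  integral is 0.\<close>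

definition stationary_initial_value ::
  "'w measure \<Rightarrow> (real \<Rightarrow> 'w \<Rightarrow> real) \<Rightarrow> real measure \<Rightarrow> ('w \<Rightarrow> real) \<Rightarrow> bool" where
  "stationary_initial_value M Z \<rho> v0 \<longleftrightarrow>
     v0 \<in> borel_measurable M \<and> (AE w in M. 0 \<le> v0 w) \<and>
     prob_space.indep_set M
       (sets (vimage_algebra (space M) v0 borel))
       (sets (vimage_algebra (space M) (\<lambda>w. \<lambda>t\<in>{0..}. Z t w) (\<Pi>\<^sub>M t\<in>{0..}. borel))) \<and>
     (\<forall>\<theta>\<ge>0. set_integrable lborel {0<..1} (\<lambda>u. levy_psi \<rho> (\<theta> * u) / u) \<and>
        levy_exponent M v0 \<theta> = (LINT u:{0<..1}|lborel. levy_psi \<rho> (\<theta> * u) / u))"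

section \<open>Likelihood and Laplace transform\<close>

text \<open>Given the actual variances \<open>T 1, \<dots>, T n\<close>, the observations are independent and Normal with the
  densities below (note that \<^const>\<open>normal_density\<close> takes the standard deviation). The data \<open>X\<close> are fixed
  numbers.\<close>

definition conditional_likelihood ::
  "real \<Rightarrow> real \<Rightarrow> real \<Rightarrow> (nat \<Rightarrow> 'w \<Rightarrow> real) \<Rightarrow> nat \<Rightarrow> (nat \<Rightarrow> real) \<Rightarrow> 'w \<Rightarrow> real" where
  "conditional_likelihood \<mu> \<beta> \<Delta> T n X w =
     (\<Prod>i=1..n. normal_density (\<mu> * \<Delta> + \<beta> * T i w) (sqrt (T i w)) (X i))"

definition likelihood ::
  "'w measure \<Rightarrow> real \<Rightarrow> real \<Rightarrow> real \<Rightarrow> (nat \<Rightarrow> 'w \<Rightarrow> real) \<Rightarrow> nat \<Rightarrow> (nat \<Rightarrow> real) \<Rightarrow> real" where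
  "likelihood M \<mu> \<beta> \<Delta> T n X = (LINT w|M. conditional_likelihood \<mu> \<beta> \<Delta> T n X w)"

definition joint_laplace ::
  "'w measure \<Rightarrow> (nat \<Rightarrow> 'w \<Rightarrow> real) \<Rightarrow> nat \<Rightarrow> (nat \<Rightarrow> real) \<Rightarrow> real" where
  "joint_laplace M T n \<theta> = (LINT w|M. exp (- (\<Sum>i=1..n. \<theta> i * T i w)))"

definition omega :: "real \<Rightarrow> (nat \<Rightarrow> real) \<Rightarrow> nat \<Rightarrow> real" where
  "omega \<beta> y i = (y i)\<^sup>2 / 2 + \<beta>\<^sup>2 / 2"

text \<open>The argument \<open>\<theta>\<close> stands for the vector of the \<open>omega \<beta> y i\<close>.\<close>

definition r_coef :: "real \<Rightarrow> real \<Rightarrow> nat \<Rightarrow> real" where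
  "r_coef lam \<Delta> i = exp (lam * real i * \<Delta>)"

definition s_coef :: "real \<Rightarrow> real \<Rightarrow> nat \<Rightarrow> (nat \<Rightarrow> real) \<Rightarrow> nat \<Rightarrow> real" where
  "s_coef lam \<Delta> n \<theta> l =
     (1 - exp (- lam * \<Delta>)) * (\<Sum>i=l..n. \<theta> i * exp (- lam * (real i - 1) * \<Delta>))"

definition v_coef :: "real \<Rightarrow> real \<Rightarrow> nat \<Rightarrow> (nat \<Rightarrow> real) \<Rightarrow> nat \<Rightarrow> real" where
  "v_coef lam \<Delta> n \<theta> i = r_coef lam \<Delta> i * s_coef lam \<Delta> n \<theta> (i + 1)"

definition Phi_cond :: "(real \<Rightarrow> real) \<Rightarrow> real \<Rightarrow> real \<Rightarrow> real \<Rightarrow> real \<Rightarrow> real" where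
  "Phi_cond \<psi> lam a q v =
     (LINT u:{exp (- a)..1}|lborel. \<psi> ((v * u + q * (1 - u)) / lam) / u)"

definition Phi_last :: "(real \<Rightarrow> real) \<Rightarrow> real \<Rightarrow> real \<Rightarrow> real \<Rightarrow> real" where
  "Phi_last \<psi> lam a q = (LINT u:{exp (- a)..1}|lborel. \<psi> (q * (1 - u) / lam) / u)"

definition varphi :: "(real \<Rightarrow> real) \<Rightarrow> real \<Rightarrow> real \<Rightarrow> real" where
  "varphi \<psi> lam s = (LINT u:{0<..1}|lborel. \<psi> (s / lam * u) / u)"

definition L1_form :: "(real \<Rightarrow> real) \<Rightarrow> real \<Rightarrow> real \<Rightarrow> nat \<Rightarrow> (nat \<Rightarrow> real) \<Rightarrow> real" where
  "L1_form \<psi> lam \<Delta> n \<theta> =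
     exp (- varphi \<psi> lam (s_coef lam \<Delta> n \<theta> 1)) *
     exp (- Phi_last \<psi> lam (lam * \<Delta>) (\<theta> n)) *
     (\<Prod>i=1..n-1. exp (- Phi_cond \<psi> lam (lam * \<Delta>) (\<theta> i) (v_coef lam \<Delta> n \<theta> i)))"

end

theory Submission
  imports Defs
begin

text \<open>
  Two independent facts combine. Both work with a general vector of weights \<open>\<theta>\<close>, later specialised to
  \<open>\<theta> i = omega \<beta> y i\<close>.

  The Laplace transform. Integrating the Ornstein--Uhlenbeck path over time and exchanging the
  order of integration turns every weighted sum of actual variances into
  \<open>h 0 * v0 + \<integral> h dZ\<close>, integrated over \<open>{0<..n * lam * \<Delta>}\<close>, for one deterministic continuous kernel \<open>h\<close>
  with \<open>h 0 = s_1 / lam\<close> (\<open>weighted_variances_eq\<close>). The Riemann--Stieltjes sums of \<open>\<integral> h dZ\<close> are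
  combinations of independent increments with known Laplace transforms, so in the limit
  \<open>E exp (- \<integral> h dZ) = exp (- \<integral> \<psi> (h r) dr)\<close>, and \<open>v0\<close> contributes an independent factor
  (\<open>laplace_path_integral\<close>). On the \<open>k\<close>-th sampling interval the substitution
  \<open>u = exp (r - k * lam * \<Delta>)\<close> makes \<open>h\<close> the affine function \<open>(v_k * u + \<theta>_k * (1 - u)) / lam\<close>, which gives the
  stated product form (\<open>joint_laplace_actual_variances\<close>).

  The likelihood. For a variance \<open>t > 0\<close>, the Normal density is a cosine transform,
  \<open>\<phi> (x | m + \<beta> t, t) = exp (A * \<beta>) / \<pi> * \<integral>\<^sub>0\<^sup>\<infinity> cos (y * A) * exp (- (y\<^sup>2 + \<beta>\<^sup>2) * t / 2) dy\<close>
  with \<open>A = x - m\<close>, because the characteristic function of a Gaussian is Gaussian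
  (\<open>normal_density_cosine_integral\<close>). Taking the product over the observations and
  the expectation over the variances yields the representation as soon as expectation and
  \<open>y\<close>-integral may be exchanged.

  If the final integrand is absolutely integrable, the exchange has to be deduced from
  integrability of \<open>L1\<close> times the cosines alone, which could a priori hold although \<open>L1\<close> itself is not
  integrable. Since \<open>cos\<^sup>2 \<le> \<bar>cos\<bar>\<close> and \<open>2 * cos\<^sup>2 z = 1 + cos (2 * z)\<close>, and a Gaussian has a positive cosine
  transform, weighting with \<open>cos\<^sup>2\<close> keeps at least half of the Gaussian mass in each coordinate;
  hence \<open>L1\<close> is integrable after all (\<open>mass_finite\<close>). In particular this excludes variances that
  vanish with positive probability.

  In the conditionally convergent case the exchange is done on boxes \<open>[0, R]^n\<close>, and the truncated cosine
  transforms are bounded by \<open>1 / \<bar>A\<bar>\<close> uniformly in \<open>R\<close> and the variance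
  (\<open>damped_cosine_bound\<close>), so dominated convergence applies. Its pointwise limit needs positive
  variances; they are bounded below by a multiple of \<open>v0\<close>, and \<open>v0 > 0\<close> almost surely because its Levy
  exponent grows at least logarithmically (\<open>v0_pos\<close>).
\<close>

section \<open>The Levy exponent of a subordinator\<close>

lemma levy_kernel_bound:
  fixes s \<theta> :: real
  assumes "0 < s" "0 \<le> \<theta>" "\<theta> \<le> B" "1 \<le> B"
  shows "1 - exp (- (s * \<theta>)) \<le> B * min 1 s"
proof -
  have "1 - exp (- (s * \<theta>)) \<le> s * \<theta>"
    using exp_ge_add_one_self[of "- (s * \<theta>)"] by linarith
  also have "\<dots> \<le> B * s"
    using assms by (simp add: mult.commute mult_left_mono)
  finally have 1: "1 - exp (- (s * \<theta>)) \<le> B * s" .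
  have "1 - exp (- (s * \<theta>)) \<le> B * 1"
    using assms exp_gt_zero[of "- (s * \<theta>)"] by linarith
  with 1 show ?thesis by (simp add: min_def)
qed

text \<open>One integrable majorant for all arguments in \<open>{0..B}\<close>, as needed for dominated convergence.\<close>

lemma levy_kernel_dominated:
  fixes s \<theta> :: real
  assumes "0 \<le> \<theta>" "\<theta> \<le> B" "1 \<le> B"
  shows "\<bar>indicator {0<..} s * (1 - exp (- (s * \<theta>)))\<bar> \<le> \<bar>B * min 1 s\<bar>"
proof (cases "0 < s")
  case True
  then have "0 \<le> 1 - exp (- (s * \<theta>))" using assms by simp
  with True levy_kernel_bound[OF True assms] show ?thesis by simp
qed simp

lemma levy_kernel_integrable:
  assumes "subordinator_levy_measure \<rho>" "0 \<le> \<theta>"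
  shows "set_integrable \<rho> {0<..} (\<lambda>s. 1 - exp (- (s * \<theta>)))"
  unfolding set_integrable_def
proof (rule Bochner_Integration.integrable_bound)
  show "integrable \<rho> (\<lambda>s. max 1 \<theta> * min 1 s)"
    using assms by (simp add: subordinator_levy_measure_def)
  have [measurable_cong]: "sets \<rho> = sets borel"
    using assms by (simp add: subordinator_levy_measure_def)
  show "(\<lambda>s. indicator {0<..} s *\<^sub>R (1 - exp (- (s * \<theta>)))) \<in> borel_measurable \<rho>"
    by measurable
  show "AE s in \<rho>. norm (indicator {0<..} s *\<^sub>R (1 - exp (- (s * \<theta>)))) \<le> norm (max 1 \<theta> * min 1 s)"
    using levy_kernel_dominated[OF assms(2), of "max 1 \<theta>"] by (intro AE_I2) simp
qed

lemma levy_psi_nonneg: "0 \<le> \<theta> \<Longrightarrow> 0 \<le> levy_psi \<rho> \<theta>"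
  unfolding levy_psi_def set_lebesgue_integral_def
  by (intro integral_nonneg_AE AE_I2) (auto simp: indicator_def)

lemma levy_psi_mono:
  assumes "subordinator_levy_measure \<rho>" "0 \<le> x" "x \<le> y"
  shows "levy_psi \<rho> x \<le> levy_psi \<rho> y"
  unfolding levy_psi_def
  by (rule set_integral_mono) (use assms in \<open>auto intro!: levy_kernel_integrable mult_left_mono\<close>)

lemma levy_psi_continuous:
  assumes "subordinator_levy_measure \<rho>"
  shows "continuous_on {0..} (levy_psi \<rho>)"
proof (rule continuous_on_sequentiallyI)
  fix u :: "nat \<Rightarrow> real" and a
  assume u: "\<forall>n. u n \<in> {0..}" and a: "a \<in> {0..}" and lim: "u \<longlonglongrightarrow> a"
  obtain K where K: "\<And>n. \<bar>u n\<bar> \<le> K"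
    using convergent_imp_Bseq[OF convergentI[OF lim]] unfolding Bseq_def by auto
  define B where "B = max 1 K"
  have uB: "u n \<le> B" "0 \<le> u n" for n using K[of n] u by (auto simp: B_def)
  have B1: "1 \<le> B" by (simp add: B_def)
  have [measurable_cong]: "sets \<rho> = sets borel"
    using assms by (simp add: subordinator_levy_measure_def)
  show "(\<lambda>n. levy_psi \<rho> (u n)) \<longlonglongrightarrow> levy_psi \<rho> a"
    unfolding levy_psi_def set_lebesgue_integral_def
  proof (rule integral_dominated_convergence)
    show "integrable \<rho> (\<lambda>s. \<bar>B * min 1 s\<bar>)"
      using assms by (intro integrable_abs) (simp add: subordinator_levy_measure_def)
    show "AE s in \<rho>. (\<lambda>n. indicator {0<..} s *\<^sub>R (1 - exp (- (s * u n)))) \<longlonglongrightarrow>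
        indicator {0<..} s *\<^sub>R (1 - exp (- (s * a)))"
      by (intro AE_I2 tendsto_intros lim)
    show "AE s in \<rho>. norm (indicator {0<..} s *\<^sub>R (1 - exp (- (s * u n)))) \<le> \<bar>B * min 1 s\<bar>" for n
      using levy_kernel_dominated[OF uB(2) uB(1) B1] by (intro AE_I2) simp
  qed measurable
qed

text \<open>If \<open>\<psi> 1\<close> vanished, the function \<open>1 - exp (- s)\<close>, which is strictly positive for \<open>s > 0\<close>, would vanish
  \<open>\<rho>\<close>-almost everywhere on the positive half-line.\<close>

lemma levy_psi_pos:
  assumes "subordinator_levy_measure \<rho>" "emeasure \<rho> {0<..} \<noteq> 0"
  shows "0 < levy_psi \<rho> 1"
proof (rule ccontr)
  assume "\<not> 0 < levy_psi \<rho> 1"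
  with levy_psi_nonneg[of 1 \<rho>] have z: "levy_psi \<rho> 1 = 0" by simp
  have S[measurable_cong]: "sets \<rho> = sets borel"
    using assms by (simp add: subordinator_levy_measure_def)
  have int: "integrable \<rho> (\<lambda>s. indicator {0<..} s *\<^sub>R (1 - exp (- (s * 1))))"
    using levy_kernel_integrable[OF assms(1), of 1] by (simp add: set_integrable_def)
  have "AE s in \<rho>. indicator {0<..} s *\<^sub>R (1 - exp (- (s * 1))) = (0::real)"
    using z integral_nonneg_eq_0_iff_AE[OF int] unfolding levy_psi_def set_lebesgue_integral_def
    by (auto simp: indicator_def)
  then have "AE s in \<rho>. s \<notin> {0<..}" by (rule AE_mp) (auto simp: indicator_def)
  then have "emeasure \<rho> {0<..} = 0"
    by (subst (asm) AE_iff_measurable[where N="{0<..}"]) (auto simp: S sets_eq_imp_space_eq[OF S])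
  with assms(2) show False by simp
qed

section \<open>The exponential formula for integrals against a subordinator\<close>

text \<open>The left-endpoint sums are integrals of step functions that converge pointwise to \<open>g\<close> and are
  bounded by its maximum. The lemma serves twice: for the path of a subordinator and for Lebesgue
  measure, so that both sides of the exponential formula come from the same grid.\<close>

lemma riemann_sum_tendsto_integral:
  fixes g :: "real \<Rightarrow> real"
  assumes sets: "sets N = sets borel" and fin: "emeasure N {0<..L} < \<infinity>"
    and g: "continuous_on {0..L} g" and L: "L > 0"
  shows "(\<lambda>m. \<Sum>j<Suc m. g (L * real j / real (Suc m)) *
      measure N {L * real j / real (Suc m)<..L * real (Suc j) / real (Suc m)})
    \<longlonglongrightarrow> (LINT r:{0<..L}|N. g r)"
proof -
  note [measurable_cong] = sets
  define x where "x m j = L * real j / real (Suc m)" for m j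
  define G where "G m r = (\<Sum>j<Suc m. g (x m j) * indicator {x m j<..x m (Suc j)} r)" for m r
  have x_mono: "x m j \<le> x m k" if "j \<le> k" for m j k
    using that L by (simp add: x_def divide_right_mono)
  have x0: "x m 0 = 0" and xL: "x m (Suc m) = L" for m by (simp_all add: x_def)
  have cell: "{x m j<..x m (Suc j)} \<subseteq> {0<..L}" if "j < Suc m" for m j
    using x_mono[of 0 j m] x_mono[of "Suc j" "Suc m" m] that x0[of m] xL[of m] by auto
  have ratio_le: "r * real (Suc m) / L \<le> real (Suc m)" if "r \<le> L" for r m
    using mult_right_mono[OF that, of "real (Suc m)"] L by (simp add: pos_divide_le_eq mult.commute)
  have cell_fin: "emeasure N {x m j<..x m (Suc j)} < \<infinity>" if "j < Suc m" for m j
    using emeasure_mono[OF cell[OF that], of N] fin sets by (metis (no_types) greaterThanAtMost_borel order_le_less_trans sets)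
  have int_ind: "integrable N (indicator {x m j<..x m (Suc j)} :: real \<Rightarrow> real)" if "j < Suc m" for m j
    using cell_fin[OF that] by (simp add: integrable_indicator_iff sets)
  have G_int: "integral\<^sup>L N (G m) = (\<Sum>j<Suc m. g (x m j) * measure N {x m j<..x m (Suc j)})" for m
    unfolding G_def
    by (subst Bochner_Integration.integral_sum) (auto intro!: int_ind simp: sets_eq_imp_space_eq[OF sets])
  obtain K where K: "\<And>r. r \<in> {0..L} \<Longrightarrow> \<bar>g r\<bar> \<le> K"
    using compact_imp_bounded[OF compact_continuous_image[OF g compact_Icc]]
    unfolding bounded_iff by (metis imageI real_norm_def)
  (* The cell that contains r is found by rounding up; y m r is the left endpoint of that cell. *)
  have cell_iff: "r \<in> {x m j<..x m (Suc j)} \<longleftrightarrow> \<lceil>r * real (Suc m) / L\<rceil> = int j + 1" for m j r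
    using L by (auto simp: x_def ceiling_eq_iff field_simps)
  define y where "y m r = x m (nat (\<lceil>r * real (Suc m) / L\<rceil> - 1))" for m r
  have G_eq: "G m r = g (y m r)" and y_near: "y m r \<le> r" "r \<le> y m r + L / real (Suc m)" "0 \<le> y m r"
    if r: "r \<in> {0<..L}" for m r
  proof -
    define k where "k = nat (\<lceil>r * real (Suc m) / L\<rceil> - 1)"
    have pos: "0 < r * real (Suc m) / L" using r L by simp
    have "r * real (Suc m) / L \<le> real (Suc m)" using r by (intro ratio_le) simp
    then have "\<lceil>r * real (Suc m) / L\<rceil> \<le> int (Suc m)" by (simp add: ceiling_le_iff)
    moreover have c1: "\<lceil>r * real (Suc m) / L\<rceil> \<ge> 1" using pos by linarith
    ultimately have k: "\<lceil>r * real (Suc m) / L\<rceil> = int k + 1" "k < Suc m"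
      by (auto simp: k_def)
    have "G m r = (\<Sum>j<Suc m. if j = k then g (x m j) else 0)"
      unfolding G_def by (intro sum.cong refl) (use cell_iff[of r m] k in \<open>auto simp: indicator_def\<close>)
    also have "\<dots> = g (x m k)" using k by (subst sum.delta) auto
    finally show "G m r = g (y m r)" by (simp add: y_def k_def)
    have yk: "y m r = x m k" by (simp add: y_def k_def)
    have "x m (Suc k) = x m k + L / real (Suc m)"
      by (simp add: x_def add_divide_distrib[symmetric] distrib_left add.commute)
    moreover have "r \<in> {x m k<..x m (Suc k)}" using cell_iff k by blast
    ultimately show "y m r \<le> r" "r \<le> y m r + L / real (Suc m)"
      unfolding yk by auto
    show "0 \<le> y m r" using L by (simp add: y_def x_def)
  qed
  have G_out: "G m r = 0" if "r \<notin> {0<..L}" for m r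
    unfolding G_def using subsetD[OF cell, of _ m r] that by (intro sum.neutral) (simp add: indicator_def, blast)
  have "(\<lambda>m. integral\<^sup>L N (G m)) \<longlonglongrightarrow> (\<integral>r. indicator {0<..L} r *\<^sub>R g r \<partial>N)"
  proof (rule integral_dominated_convergence)
    show "(\<lambda>r. indicator {0<..L} r *\<^sub>R g r) \<in> borel_measurable N"
    proof -
      have "set_borel_measurable borel {0<..L} g"
        by (rule set_measurable_continuous_on) (auto intro: continuous_on_subset[OF g])
      then show ?thesis unfolding set_borel_measurable_def by (simp cong: measurable_cong_sets[OF sets refl])
    qed
    show "G m \<in> borel_measurable N" for m unfolding G_def by measurable
    show "integrable N (\<lambda>r. K * indicator {0<..L} r)"
      using fin sets by (intro integrable_mult_right) (auto simp: integrable_indicator_iff)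
    show "AE r in N. norm (G m r) \<le> K * indicator {0<..L} r" for m
    proof (rule AE_I2)
      fix r show "norm (G m r) \<le> K * indicator {0<..L} r"
      proof (cases "r \<in> {0<..L}")
        case True
        with y_near[OF True, of m] K[of "y m r"] show ?thesis by (simp add: G_eq)
      qed (simp add: G_out)
    qed
    show "AE r in N. (\<lambda>m. G m r) \<longlonglongrightarrow> indicator {0<..L} r *\<^sub>R g r"
    proof (rule AE_I2)
      fix r show "(\<lambda>m. G m r) \<longlonglongrightarrow> indicator {0<..L} r *\<^sub>R g r"
      proof (cases "r \<in> {0<..L}")
        case True
        have "(\<lambda>m. y m r) \<longlonglongrightarrow> r"
        proof (rule real_tendsto_sandwich)
          show "\<forall>\<^sub>F m in sequentially. r - L / real (Suc m) \<le> y m r"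
            using y_near[OF True] by (auto simp: algebra_simps)
          show "\<forall>\<^sub>F m in sequentially. y m r \<le> r" using y_near[OF True] by auto
          show "(\<lambda>m. r - L / real (Suc m)) \<longlonglongrightarrow> r"
            using tendsto_diff[OF tendsto_const LIMSEQ_Suc[OF lim_const_over_n[of L]], of r] by simp
        qed auto
        then have "(\<lambda>m. g (y m r)) \<longlonglongrightarrow> g r"
          by (rule continuous_on_tendsto_compose[OF g])
             (use True y_near[OF True] in \<open>auto intro!: always_eventually order_trans[of _ r L]\<close>)
        then show ?thesis using True by (simp add: G_eq)
      qed (simp add: G_out)
    qed
  qed
  then show ?thesis by (simp add: G_int set_lebesgue_integral_def x_def)
qed

locale subordinator_model =
  fixes M :: "'w measure" and Z :: "real \<Rightarrow> 'w \<Rightarrow> real" and \<rho> :: "real measure"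
  assumes subordinator: "subordinator M Z \<rho>"
begin

sublocale prob_space M
  using subordinator by (simp add: subordinator_def)

lemma levy_measure: "subordinator_levy_measure \<rho>"
  using subordinator by (simp add: subordinator_def)

lemma Z_measurable: "0 \<le> t \<Longrightarrow> Z t \<in> borel_measurable M"
  using subordinator by (simp add: subordinator_def)

lemma path_mono:
  assumes "w \<in> space M" "0 \<le> s" "s \<le> t" shows "Z s w \<le> Z t w"
proof -
  have "mono_on {0..} (\<lambda>t. Z t w)" using subordinator assms(1) by (simp add: subordinator_def)
  then show ?thesis using assms by (intro mono_onD[of "{0..}" "\<lambda>t. Z t w"]) auto
qed

text \<open>The Lebesgue--Stieltjes measure that underlies \<^const>\<open>sub_integral\<close>.\<close>

definition path_measure :: "'w \<Rightarrow> real measure" where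
  "path_measure w = interval_measure (\<lambda>x. Z (max 0 x) w)"

lemma extended_path_mono:
  assumes "w \<in> space M" "x \<le> y" shows "Z (max 0 x) w \<le> Z (max 0 y) w"
  using assms by (intro path_mono) auto

lemma extended_path_right_continuous:
  assumes "w \<in> space M" shows "continuous (at_right a) (\<lambda>x. Z (max 0 x) w)"
proof (cases "a \<ge> 0")
  case True
  have "continuous (at_right a) (\<lambda>r. Z r w)"
    using subordinator assms True by (simp add: subordinator_def)
  then have "((\<lambda>r. Z r w) \<longlongrightarrow> Z a w) (at_right a)" by (simp add: continuous_within)
  moreover have "\<forall>\<^sub>F x in at_right a. Z x w = Z (max 0 x) w"
    using True by (intro eventually_at_rightI[of a "a + 1"]) auto
  ultimately have "((\<lambda>x. Z (max 0 x) w) \<longlongrightarrow> Z a w) (at_right a)"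
    by (rule Lim_transform_eventually)
  then show ?thesis using True by (simp add: continuous_within)
next
  case False
  have "\<forall>\<^sub>F x in at_right a. Z 0 w = Z (max 0 x) w"
    using False by (intro eventually_at_rightI[of a 0]) auto
  then have "((\<lambda>x. Z (max 0 x) w) \<longlongrightarrow> Z 0 w) (at_right a)"
    by (rule Lim_transform_eventually[OF tendsto_const])
  then show ?thesis using False by (simp add: continuous_within)
qed

lemma sets_path_measure [simp, measurable_cong]: "sets (path_measure w) = sets borel"
  by (simp add: path_measure_def)

lemma space_path_measure [simp]: "space (path_measure w) = UNIV"
  by (simp add: path_measure_def)

lemma sigma_finite_path_measure: "w \<in> space M \<Longrightarrow> sigma_finite_measure (path_measure w)"
  unfolding path_measure_def
  by (intro sigma_finite_interval_measure extended_path_mono extended_path_right_continuous)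

lemma emeasure_path_measure:
  assumes "w \<in> space M" "0 \<le> s" "s \<le> t"
  shows "emeasure (path_measure w) {s<..t} = ennreal (Z t w - Z s w)"
  using assms unfolding path_measure_def
  by (subst emeasure_interval_measure_Ioc)
     (auto intro!: extended_path_mono extended_path_right_continuous)

lemma measure_path_measure:
  assumes "w \<in> space M" "0 \<le> s" "s \<le> t"
  shows "measure (path_measure w) {s<..t} = Z t w - Z s w"
  using emeasure_path_measure[OF assms] path_mono[OF assms] by (simp add: measure_def)

text \<open>The exponential formula for step functions: independence factorises the expectation, stationarity identifies the factors.\<close>

lemma laplace_increments:
  fixes t c :: "nat \<Rightarrow> real"
  assumes t: "0 \<le> t 0" "incseq t" and c: "\<And>j. 0 \<le> c j"
  shows "(LINT w|M. exp (- (\<Sum>j<k. c j * (Z (t (Suc j)) w - Z (t j) w))))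
    = exp (- (\<Sum>j<k. (t (Suc j) - t j) * levy_psi \<rho> (c j)))"
proof -
  have t_nonneg: "0 \<le> t j" for j using t incseqD[of t 0 j] by simp
  have t_le: "t j \<le> t (Suc j)" for j using t by (simp add: incseq_SucD)
  note [measurable] = Z_measurable[OF t_nonneg]
  have "indep_vars (\<lambda>_. borel) (\<lambda>i w. Z (t (Suc i)) w - Z (t i) w) {..<k}"
    using subordinator t by (simp add: subordinator_def)
  then have ind: "indep_vars (\<lambda>_. borel) (\<lambda>j w. exp (- (c j * (Z (t (Suc j)) w - Z (t j) w)))) {..<k}"
    by (rule indep_vars_compose2[where Y="\<lambda>j x. exp (- (c j * x))"]) measurable
  have int: "integrable M (\<lambda>w. exp (- (c j * (Z (t (Suc j)) w - Z (t j) w))))" for j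
  proof (rule integrable_const_bound[where B=1])
    show "AE w in M. norm (exp (- (c j * (Z (t (Suc j)) w - Z (t j) w)))) \<le> 1"
      by (intro AE_I2) (use c[of j] path_mono[OF _ t_nonneg t_le] in auto)
  qed measurable
  have one: "(LINT w|M. exp (- (c j * (Z (t (Suc j)) w - Z (t j) w))))
      = exp (- ((t (Suc j) - t j) * levy_psi \<rho> (c j)))" for j
  proof -
    have d0: "0 \<le> t (Suc j) - t j" using t_le[of j] by simp
    have "distr M borel (\<lambda>w. Z (t (Suc j)) w - Z (t j) w) = distr M borel (Z (t (Suc j) - t j))"
      using subordinator t_nonneg t_le by (simp add: subordinator_def)
    then have "(LINT x|distr M borel (\<lambda>w. Z (t (Suc j)) w - Z (t j) w). exp (- (c j * x)))
       = (LINT x|distr M borel (Z (t (Suc j) - t j)). exp (- (c j * x)))" by simp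
    then have "(LINT w|M. exp (- (c j * (Z (t (Suc j)) w - Z (t j) w))))
       = (LINT w|M. exp (- (c j * Z (t (Suc j) - t j) w)))"
      using Z_measurable[OF d0] by (simp add: integral_distr)
    also have "\<dots> = exp (- ((t (Suc j) - t j) * levy_psi \<rho> (c j)))"
      using subordinator d0 c by (simp add: subordinator_def)
    finally show ?thesis .
  qed
  have "(LINT w|M. exp (- (\<Sum>j<k. c j * (Z (t (Suc j)) w - Z (t j) w))))
     = (LINT w|M. (\<Prod>j<k. exp (- (c j * (Z (t (Suc j)) w - Z (t j) w)))))"
    by (simp only: sum_negf[symmetric] exp_sum[OF finite_lessThan])
  also have "\<dots> = (\<Prod>j<k. LINT w|M. exp (- (c j * (Z (t (Suc j)) w - Z (t j) w))))"
    by (rule indep_vars_lebesgue_integral[OF _ ind int]) simp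
  also have "\<dots> = exp (- (\<Sum>j<k. (t (Suc j) - t j) * levy_psi \<rho> (c j)))"
    by (simp only: one sum_negf[symmetric] exp_sum[OF finite_lessThan])
  finally show ?thesis .
qed

definition grid_sum :: "real \<Rightarrow> (real \<Rightarrow> real) \<Rightarrow> nat \<Rightarrow> 'w \<Rightarrow> real" where
  "grid_sum L h m w = (\<Sum>j<Suc m. h (L * real j / real (Suc m)) *
     (Z (L * real (Suc j) / real (Suc m)) w - Z (L * real j / real (Suc m)) w))"

lemma grid_sum_tendsto:
  assumes "w \<in> space M" "continuous_on {0..L} h" "L > 0"
  shows "(\<lambda>m. grid_sum L h m w) \<longlonglongrightarrow> (LINT r:{0<..L}|path_measure w. h r)"
proof -
  have "(\<lambda>m. \<Sum>j<Suc m. h (L * real j / real (Suc m)) *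
      measure (path_measure w) {L * real j / real (Suc m)<..L * real (Suc j) / real (Suc m)})
    \<longlonglongrightarrow> (LINT r:{0<..L}|path_measure w. h r)"
    using assms by (intro riemann_sum_tendsto_integral) (auto simp: emeasure_path_measure)
  also have "(\<lambda>m. \<Sum>j<Suc m. h (L * real j / real (Suc m)) *
      measure (path_measure w) {L * real j / real (Suc m)<..L * real (Suc j) / real (Suc m)})
    = (\<lambda>m. grid_sum L h m w)"
    unfolding grid_sum_def using assms
    by (intro ext sum.cong refl arg_cong2[where f="(*)"] measure_path_measure)
       (auto simp: divide_right_mono)
  finally show ?thesis .
qed

lemma grid_sum_measurable:
  assumes "L \<ge> 0" and N: "\<And>t. 0 \<le> t \<Longrightarrow> Z t \<in> borel_measurable N"
  shows "grid_sum L h m \<in> borel_measurable N"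
  unfolding grid_sum_def using assms(1)
  by (intro borel_measurable_sum borel_measurable_times borel_measurable_diff borel_measurable_const N) auto

lemma path_integral_measurable:
  fixes h :: "real \<Rightarrow> real"
  assumes "continuous_on {0..L} h" "L > 0"
  shows "(\<lambda>w. LINT r:{0<..L}|path_measure w. h r) \<in> borel_measurable M"
proof (rule borel_measurable_LIMSEQ_metric)
  show "grid_sum L h m \<in> borel_measurable M" for m
    using assms by (intro grid_sum_measurable Z_measurable) auto
  show "(\<lambda>m. grid_sum L h m w) \<longlonglongrightarrow> (LINT r:{0<..L}|path_measure w. h r)" if "w \<in> space M" for w
    by (rule grid_sum_tendsto[OF that assms])
qed

end

locale stationary_subordinator_model = subordinator_model M Z \<rho>
  for M :: "'w measure" and Z :: "real \<Rightarrow> 'w \<Rightarrow> real" and \<rho> :: "real measure" +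
  fixes v0 :: "'w \<Rightarrow> real"
  assumes stationary: "stationary_initial_value M Z \<rho> v0"
begin

lemma v0_measurable [measurable]: "v0 \<in> borel_measurable M"
  using stationary by (simp add: stationary_initial_value_def)

lemma v0_nonneg: "AE w in M. 0 \<le> v0 w"
  using stationary by (simp add: stationary_initial_value_def)

lemma integrable_exp_v0:
  assumes "0 \<le> b" shows "integrable M (\<lambda>w. exp (- (b * v0 w)))"
  by (rule integrable_const_bound[where B=1])
     (use v0_nonneg assms in \<open>auto elim!: eventually_mono\<close>)

lemma laplace_v0:
  assumes "0 \<le> b" shows "(LINT w|M. exp (- (b * v0 w))) = exp (- levy_exponent M v0 b)"
proof -
  have "(LINT w|M. exp (- (b * v0 w))) \<noteq> 0"
    using integral_nonneg_eq_0_iff_AE[OF integrable_exp_v0[OF assms]] by auto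
  moreover have "(LINT w|M. exp (- (b * v0 w))) \<ge> 0" by (intro integral_nonneg_AE) auto
  ultimately have "(LINT w|M. exp (- (b * v0 w))) > 0" by linarith
  then show ?thesis by (simp add: levy_exponent_def)
qed

lemma levy_exponent_v0:
  assumes "0 \<le> b"
  shows "levy_exponent M v0 b = (LINT u:{0<..1}|lborel. levy_psi \<rho> (b * u) / u)"
    and "set_integrable lborel {0<..1} (\<lambda>u. levy_psi \<rho> (b * u) / u)"
  using stationary assms by (simp_all add: stationary_initial_value_def)

text \<open>A grid sum depends on finitely many values of the process, so its \<open>\<sigma>\<close>-algebra lies in the one generated by
  the whole path on the nonnegative half-line.\<close>

lemma v0_indep_grid_sum:
  assumes "L \<ge> 0"
  shows "indep_var borel v0 borel (grid_sum L h m)"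
proof -
  let ?Z = "vimage_algebra (space M) (\<lambda>w. \<lambda>t\<in>{0..}. Z t w) (\<Pi>\<^sub>M t\<in>{0..}. borel)"
  let ?V = "vimage_algebra (space M) v0 borel"
  have ind: "indep_set (sets ?V) (sets ?Z)"
    using stationary by (simp add: stationary_initial_value_def)
  have Zm: "Z t \<in> borel_measurable ?Z" if "0 \<le> t" for t
  proof -
    have "(\<lambda>w. \<lambda>t\<in>{0..}. Z t w) \<in> measurable ?Z (\<Pi>\<^sub>M t\<in>{0..}. borel)"
      by (rule measurable_vimage_algebra1) (auto simp: space_PiM)
    from measurable_compose[OF this measurable_component_singleton[of t "{0..}" "\<lambda>_. borel"]]
    have "(\<lambda>w. (\<lambda>t\<in>{0..}. Z t w) t) \<in> borel_measurable ?Z"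
      using that by simp
    then show ?thesis using that by simp
  qed
  have gm: "grid_sum L h m \<in> borel_measurable ?Z"
    by (rule grid_sum_measurable[OF assms Zm])
  (* Both generated algebras are contained in those that are independent by hypothesis. *)
  have sub1: "sigma_sets (space M) {v0 -` A \<inter> space M |A. A \<in> sets borel} \<subseteq> sets ?V"
    by (rule sets.sigma_sets_subset[of _ ?V, simplified]) (auto intro: in_vimage_algebra)
  have sub2: "sigma_sets (space M) {grid_sum L h m -` A \<inter> space M |A. A \<in> sets borel} \<subseteq> sets ?Z"
    by (rule sets.sigma_sets_subset[of _ ?Z, simplified]) (use measurable_sets[OF gm] in auto)
  show ?thesis
    unfolding indep_var_eq
  proof (intro conjI)
    show "grid_sum L h m \<in> borel_measurable M"
      by (rule grid_sum_measurable[OF assms Z_measurable])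
    show "indep_set (sigma_sets (space M) {v0 -` A \<inter> space M |A. A \<in> sets borel})
       (sigma_sets (space M) {grid_sum L h m -` A \<inter> space M |A. A \<in> sets borel})"
      using ind unfolding indep_set_def
      by (rule indep_sets_mono_sets) (use sub1 sub2 in \<open>auto split: bool.split\<close>)
  qed simp
qed

text \<open>The exponential formula \<open>E exp (- \<integral> h dZ) = exp (- \<integral> \<psi> (h r) dr)\<close>, jointly with the initial value: it
  holds for step functions, and both sides pass to the limit, on the left by bounded convergence
  since all the exponents are almost surely nonpositive.\<close>

lemma laplace_path_integral:
  assumes b: "0 \<le> b" and L: "L > 0" and h: "continuous_on {0..L} h" "\<And>r. 0 \<le> h r"
  shows "(LINT w|M. exp (- (b * v0 w + (LINT r:{0<..L}|path_measure w. h r))))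
    = exp (- levy_exponent M v0 b) * exp (- (LINT r:{0<..L}|lborel. levy_psi \<rho> (h r)))"
proof -
  let ?t = "\<lambda>m j. L * real j / real (Suc m)"
  have t_inc: "incseq (?t m)" for m
    using L by (auto simp: incseq_def intro!: divide_right_mono)
  have t_nonneg: "0 \<le> ?t m j" for m j using L by simp
  note [measurable] = grid_sum_measurable[OF less_imp_le[OF L] Z_measurable]
    path_integral_measurable[OF h(1) L]
  have grid_nonneg: "0 \<le> grid_sum L h m w" if "w \<in> space M" for m w
    unfolding grid_sum_def
    by (intro sum_nonneg mult_nonneg_nonneg h)
       (use path_mono[OF that t_nonneg incseq_SucD[OF t_inc]] in simp)
  have int_grid: "integrable M (\<lambda>w. exp (- grid_sum L h m w))" for m
    by (rule integrable_const_bound[where B=1]) (auto intro!: AE_I2 grid_nonneg)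
  have step: "(LINT w|M. exp (- (b * v0 w + grid_sum L h m w)))
    = exp (- levy_exponent M v0 b) * exp (- (\<Sum>j<Suc m. levy_psi \<rho> (h (?t m j)) * measure lborel {?t m j<..?t m (Suc j)}))" for m
  proof -
    have "indep_var borel ((\<lambda>x. exp (- (b * x))) \<circ> v0) borel ((\<lambda>x. exp (- x)) \<circ> grid_sum L h m)"
      by (rule indep_var_compose[OF v0_indep_grid_sum]) (use L in auto)
    then have ind: "indep_var borel (\<lambda>w. exp (- (b * v0 w))) borel (\<lambda>w. exp (- grid_sum L h m w))"
      by (simp add: comp_def)
    have "(LINT w|M. exp (- (b * v0 w + grid_sum L h m w)))
       = (LINT w|M. exp (- (b * v0 w)) * exp (- grid_sum L h m w))"
      by (simp add: exp_add[symmetric])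
    also have "\<dots> = (LINT w|M. exp (- (b * v0 w))) * (LINT w|M. exp (- grid_sum L h m w))"
      by (rule indep_var_lebesgue_integral[OF ind integrable_exp_v0[OF b] int_grid])
    also have "(LINT w|M. exp (- grid_sum L h m w)) = exp (- (\<Sum>j<Suc m. (?t m (Suc j) - ?t m j) * levy_psi \<rho> (h (?t m j))))"
      unfolding grid_sum_def using t_inc h(2) by (intro laplace_increments) auto
    also have "(\<Sum>j<Suc m. (?t m (Suc j) - ?t m j) * levy_psi \<rho> (h (?t m j)))
       = (\<Sum>j<Suc m. levy_psi \<rho> (h (?t m j)) * measure lborel {?t m j<..?t m (Suc j)})"
      by (intro sum.cong refl) (use incseq_SucD[OF t_inc] in \<open>simp add: mult.commute\<close>)
    finally show ?thesis by (simp add: laplace_v0[OF b])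
  qed
  have "(\<lambda>m. LINT w|M. exp (- (b * v0 w + grid_sum L h m w)))
     \<longlonglongrightarrow> (LINT w|M. exp (- (b * v0 w + (LINT r:{0<..L}|path_measure w. h r))))"
  proof (rule integral_dominated_convergence[where w="\<lambda>_. 1"])
    show "AE w in M. (\<lambda>m. exp (- (b * v0 w + grid_sum L h m w)))
      \<longlonglongrightarrow> exp (- (b * v0 w + (LINT r:{0<..L}|path_measure w. h r)))"
      by (intro AE_I2 tendsto_intros grid_sum_tendsto h L)
    show "AE w in M. norm (exp (- (b * v0 w + grid_sum L h m w))) \<le> 1" for m
      using v0_nonneg AE_space
    proof eventually_elim
      fix w assume "0 \<le> v0 w" "w \<in> space M"
      then have "0 \<le> b * v0 w + grid_sum L h m w"
        using b by (intro add_nonneg_nonneg mult_nonneg_nonneg grid_nonneg)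
      then show "norm (exp (- (b * v0 w + grid_sum L h m w))) \<le> 1" by simp
    qed
  qed (auto)
  moreover have "(\<lambda>m. exp (- levy_exponent M v0 b) *
      exp (- (\<Sum>j<Suc m. levy_psi \<rho> (h (?t m j)) * measure lborel {?t m j<..?t m (Suc j)})))
    \<longlonglongrightarrow> exp (- levy_exponent M v0 b) * exp (- (LINT r:{0<..L}|lborel. levy_psi \<rho> (h r)))"
  proof (intro tendsto_intros riemann_sum_tendsto_integral L)
    show "continuous_on {0..L} (\<lambda>r. levy_psi \<rho> (h r))"
      by (rule continuous_on_compose2[OF levy_psi_continuous[OF levy_measure] h(1)]) (use h(2) in auto)
  qed (use L in auto)
  ultimately show ?thesis unfolding step by (rule LIMSEQ_unique)
qed

end

section \<open>Actual variances of the stationary Ornstein--Uhlenbeck process\<close>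

text \<open>The contribution to the variance integrated over \<open>{p..q}\<close> of a unit jump of the driving process at its own
  time \<open>r\<close>, which is time \<open>r / lam\<close> of the Ornstein--Uhlenbeck process. The minima merge the three
  regimes (before, during and after the interval) into one visibly continuous expression.\<close>

definition ou_kernel :: "real \<Rightarrow> real \<Rightarrow> real \<Rightarrow> real \<Rightarrow> real" where
  "ou_kernel lam p q r = (exp (min 0 (r - lam * p)) - exp (min 0 (r - lam * q))) / lam"

lemma ou_kernel_continuous: "continuous_on S (ou_kernel lam p q)"
  unfolding ou_kernel_def divide_inverse by (intro continuous_intros)

lemma ou_kernel_nonneg:
  assumes "lam > 0" "p \<le> q" shows "0 \<le> ou_kernel lam p q r"
proof -
  have "lam * p \<le> lam * q" using assms by simp
  then have "min 0 (r - lam * q) \<le> min 0 (r - lam * p)" by linarith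
  then show ?thesis using assms unfolding ou_kernel_def by (intro divide_nonneg_pos) auto
qed

lemma ou_kernel_before:
  assumes "r \<le> lam * p" "lam * p \<le> lam * q"
  shows "ou_kernel lam p q r = exp r * (exp (- (lam * p)) - exp (- (lam * q))) / lam"
proof -
  have "min 0 (r - lam * p) = r - lam * p" "min 0 (r - lam * q) = r - lam * q"
    using assms by (auto intro!: min_absorb2)
  then show ?thesis by (simp add: ou_kernel_def exp_diff exp_minus divide_inverse right_diff_distrib)
qed

lemma discounting_integral:
  fixes lam p q :: real
  assumes "lam > 0" "p \<le> q"
  shows "(LINT s:{p..q}|lborel. exp (x - lam * s)) = (exp (x - lam * p) - exp (x - lam * q)) / lam"
    and "set_integrable lborel {p..q} (\<lambda>s. exp (x - lam * s))"
proof -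
  have "(LINT s|lborel. indicator {p..q} s *\<^sub>R exp (x - lam * s))
      = - (exp (x - lam * q) / lam) - - (exp (x - lam * p) / lam)"
    by (rule integral_FTC_Icc[OF assms(2)])
       (use assms in \<open>auto intro!: derivative_eq_intros continuous_intros
          simp: has_real_derivative_iff_has_vector_derivative[symmetric]\<close>)
  then show "(LINT s:{p..q}|lborel. exp (x - lam * s)) = (exp (x - lam * p) - exp (x - lam * q)) / lam"
    by (simp add: set_lebesgue_integral_def diff_divide_distrib)
  show "set_integrable lborel {p..q} (\<lambda>s. exp (x - lam * s))"
    unfolding set_integrable_def by (rule borel_integrable_compact) (auto intro!: continuous_intros)
qed

text \<open>The kernel is the discounting factor integrated over the part of \<open>{p..q}\<close> that follows the jump
  at \<open>r / lam\<close>.\<close>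

lemma ou_kernel_as_integral:
  fixes lam p q r :: real
  assumes lam: "lam > 0" and pq: "p \<le> q"
  shows "(LINT s:{p..q}|lborel. indicator {..lam * s} r * exp (r - lam * s)) = ou_kernel lam p q r"
proof (cases "r \<le> lam * q")
  case True
  (* The jump is felt from time r / lam on, at the earliest from the start of the interval. *)
  define p' where "p' = max p (r / lam)"
  have p': "p' \<le> q" using True pq lam by (simp add: p'_def pos_divide_le_eq mult.commute)
  have "(LINT s:{p..q}|lborel. indicator {..lam * s} r * exp (r - lam * s))
     = (LINT s:{p'..q}|lborel. exp (r - lam * s))"
    unfolding set_lebesgue_integral_def
    by (intro Bochner_Integration.integral_cong refl)
       (use lam in \<open>auto simp: indicator_def p'_def pos_divide_le_eq mult.commute\<close>)
  also have "\<dots> = (exp (r - lam * p') - exp (r - lam * q)) / lam"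
    by (rule discounting_integral[OF lam p'])
  also have "r - lam * p' = min 0 (r - lam * p)"
    using lam by (auto simp: p'_def max_def min_def pos_divide_le_eq pos_le_divide_eq mult.commute)
  finally show ?thesis using True by (simp add: ou_kernel_def min_def)
next
  case False
  have z: "indicator {p..q} s *\<^sub>R (indicator {..lam * s} r * exp (r - lam * s)) = (0::real)" for s
  proof -
    have "s \<le> q \<Longrightarrow> lam * s \<le> lam * q" using lam by simp
    then show ?thesis using False by (auto simp: indicator_def)
  qed
  have "lam * p \<le> lam * q" using lam pq by simp
  with False show ?thesis unfolding set_lebesgue_integral_def z by (simp add: ou_kernel_def min_def)
qed

text \<open>Exchanging the time integral and the Stieltjes integral. The integrand \<open>exp (r - lam * s)\<close> on
  \<open>r \<le> lam * s\<close> is at most 1 on a rectangle of finite measure, so Fubini applies.\<close>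

lemma ou_fubini:
  fixes N :: "real measure"
  assumes sets: "sets N = sets borel" and sf: "sigma_finite_measure N"
    and fin: "emeasure N {0<..L} < \<infinity>"
    and lam: "lam > 0" and pq: "p \<le> q" and L: "lam * q \<le> L"
  shows "(LINT s:{p..q}|lborel. exp (- lam * s) * (LINT r:{0<..lam * s}|N. exp r))
       = (LINT r:{0<..L}|N. ou_kernel lam p q r)"
    and "set_integrable lborel {p..q} (\<lambda>s. exp (- lam * s) * (LINT r:{0<..lam * s}|N. exp r))"
proof -
  note [measurable_cong] = sets
  interpret N: sigma_finite_measure N by fact
  interpret P: pair_sigma_finite N "lborel :: real measure" ..
  define f where "f r s = indicator {0<..L} r * (indicator {p..q} s * (indicator {..lam * s} r * exp (r - lam * s)))"
    for r s :: real
  have f_alt: "f r s = indicator {0<..L} r * (indicator {p..q} s * (if r \<le> lam * s then exp (r - lam * s) else 0))" for r s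
    by (simp add: f_def indicator_def)
  have f_meas [measurable]: "(\<lambda>(r, s). f r s) \<in> borel_measurable (N \<Otimes>\<^sub>M lborel)"
    unfolding f_alt by measurable
  have int: "integrable (N \<Otimes>\<^sub>M lborel) (\<lambda>(r, s). f r s)"
  proof (rule Bochner_Integration.integrable_bound[where f="indicator ({0<..L} \<times> {p..q}) :: _ \<Rightarrow> real"])
    have "emeasure (N \<Otimes>\<^sub>M lborel) ({0<..L} \<times> {p..q}) = emeasure N {0<..L} * emeasure lborel {p..q}"
      by (rule lborel.emeasure_pair_measure_Times) (auto simp: sets)
    also have "\<dots> < \<infinity>" using fin pq by (simp add: ennreal_mult_less_top)
    finally show "integrable (N \<Otimes>\<^sub>M lborel) (indicator ({0<..L} \<times> {p..q}) :: _ \<Rightarrow> real)"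
      by (subst integrable_indicator_iff) (auto simp: sets)
    show "AE x in N \<Otimes>\<^sub>M lborel. norm (case x of (r, s) \<Rightarrow> f r s) \<le> norm (indicator ({0<..L} \<times> {p..q}) x :: real)"
      by (intro AE_I2) (auto simp: f_def indicator_def)
  qed (rule f_meas)
  have inner_r: "(LINT r|N. f r s) = indicator {p..q} s * (exp (- lam * s) * (LINT r:{0<..lam * s}|N. exp r))" for s
  proof -
    have eq: "f r s = (indicator {p..q} s * exp (- lam * s)) * (indicator {0<..lam * s} r * exp r)" for r
    proof (cases "s \<in> {p..q}")
      case True
      then have "lam * s \<le> lam * q" using lam by simp
      with L have "lam * s \<le> L" by simp
      then show ?thesis by (auto simp: f_def indicator_def exp_diff exp_minus divide_inverse)
    qed (simp add: f_def)
    show ?thesis unfolding eq set_lebesgue_integral_def by simp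
  qed
  have inner_s: "(LINT s|lborel. f r s) = indicator {0<..L} r * ou_kernel lam p q r" for r
  proof -
    have "(LINT s|lborel. f r s) = indicator {0<..L} r *
        (LINT s:{p..q}|lborel. indicator {..lam * s} r * exp (r - lam * s))"
      by (simp add: f_def set_lebesgue_integral_def)
    then show ?thesis by (simp only: ou_kernel_as_integral[OF lam pq])
  qed
  show "(LINT s:{p..q}|lborel. exp (- lam * s) * (LINT r:{0<..lam * s}|N. exp r))
       = (LINT r:{0<..L}|N. ou_kernel lam p q r)"
    using P.Fubini_integral[OF int] by (simp add: inner_r inner_s set_lebesgue_integral_def)
  show "set_integrable lborel {p..q} (\<lambda>s. exp (- lam * s) * (LINT r:{0<..lam * s}|N. exp r))"
    using P.integrable_snd[OF int] by (simp add: inner_r set_integrable_def)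
qed

text \<open>The initial value decays like a jump at time 0, so its coefficient is the kernel at 0.\<close>

lemma (in stationary_subordinator_model) actual_variance_eq:
  assumes w: "w \<in> space M" and lam: "lam > 0" and D: "\<Delta> > 0" and i: "1 \<le> i" and L: "lam * (real i * \<Delta>) \<le> L"
  shows "actual_variance Z v0 lam \<Delta> i w
    = ou_kernel lam ((real i - 1) * \<Delta>) (real i * \<Delta>) 0 * v0 w
      + (LINT r:{0<..L}|path_measure w. ou_kernel lam ((real i - 1) * \<Delta>) (real i * \<Delta>) r)"
proof -
  let ?p = "(real i - 1) * \<Delta>" and ?q = "real i * \<Delta>"
  have pq: "?p \<le> ?q" "0 \<le> ?p" using D i by (auto simp: mult_right_mono)
  have "0 \<le> lam * ?q" using lam D i by simp
  then have "emeasure (path_measure w) {0<..L} < \<infinity>"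
    using L w by (subst emeasure_path_measure) auto
  note fub = ou_fubini[OF sets_path_measure sigma_finite_path_measure[OF w] this lam pq(1) L]
  have "ou_process Z v0 lam s w = v0 w * exp (0 - lam * s) + exp (- lam * s) * (LINT r:{0<..lam * s}|path_measure w. exp r)" for s
    using lam by (simp add: ou_process_def sub_integral_def path_measure_def mult.commute)
  then have "actual_variance Z v0 lam \<Delta> i w
    = (LINT s:{?p..?q}|lborel. v0 w * exp (0 - lam * s) + exp (- lam * s) * (LINT r:{0<..lam * s}|path_measure w. exp r))"
    unfolding actual_variance_def by simp
  also have "\<dots> = (LINT s:{?p..?q}|lborel. v0 w * exp (0 - lam * s))
     + (LINT s:{?p..?q}|lborel. exp (- lam * s) * (LINT r:{0<..lam * s}|path_measure w. exp r))"
    using discounting_integral(2)[OF lam pq(1), of 0] by (intro set_integral_add fub) auto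
  also have "(LINT s:{?p..?q}|lborel. v0 w * exp (0 - lam * s)) = v0 w * ((exp (0 - lam * ?p) - exp (0 - lam * ?q)) / lam)"
    by (subst discounting_integral(1)[OF lam pq(1), symmetric]) simp
  also have "(exp (0 - lam * ?p) - exp (0 - lam * ?q)) / lam = ou_kernel lam ?p ?q 0"
    using lam pq by (subst ou_kernel_before) (auto intro: mult_left_mono)
  finally show ?thesis by (simp only: fub(1) mult.commute[of "v0 w"])
qed

text \<open>The substitution \<open>u = exp (r - c)\<close>, under which \<open>du / u\<close> becomes \<open>dr\<close>.\<close>

lemma Phi_cond_eq_path_integral:
  assumes psi: "continuous_on {0..} \<psi>" and lam: "lam > 0" and a: "0 \<le> a" and q: "0 \<le> q" and v: "0 \<le> v"
  shows "Phi_cond \<psi> lam a q v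
    = (LINT r:{c - a..c}|lborel. \<psi> ((v * exp (r - c) + q * (1 - exp (r - c))) / lam))"
proof -
  let ?f = "\<lambda>u. \<psi> ((v * u + q * (1 - u)) / lam) / u"
  let ?g = "\<lambda>r. exp (r - c)"
  have "continuous_on {exp (- a)..1} ?f"
  proof (intro continuous_intros continuous_on_compose2[OF psi])
    show "(\<lambda>u. (v * u + q * (1 - u)) / lam) ` {exp (- a)..1} \<subseteq> {0..}"
    proof clarsimp
      fix u assume "exp (- a) \<le> u" "u \<le> 1"
      then have "0 \<le> u" "u \<le> 1" using exp_ge_zero[of "- a"] by linarith+
      then show "0 \<le> (v * u + q * (1 - u)) / lam" using lam q v by simp
    qed
    show "\<forall>u\<in>{exp (- a)..1}. u \<noteq> 0" using exp_gt_zero[of "- a"] by (auto simp del: exp_gt_zero)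
  qed (use lam in auto)
  then have "set_integrable lborel {exp (- a)..1} ?f"
    unfolding set_integrable_def by (rule borel_integrable_compact[OF compact_Icc])
  then have "set_integrable lborel {?g (c - a)..?g c} ?f" by simp
  then have "(LBINT u. ?f u * indicator {?g (c - a)..?g c} u)
      = (LBINT r. ?f (?g r) * exp (r - c) * indicator {c - a..c} r)"
    by (rule integral_substitution) (use a in \<open>auto intro!: derivative_eq_intros continuous_intros\<close>)
  then show ?thesis by (simp add: Phi_cond_def set_lebesgue_integral_def mult.commute)
qed

definition combined_kernel :: "real \<Rightarrow> real \<Rightarrow> nat \<Rightarrow> (nat \<Rightarrow> real) \<Rightarrow> real \<Rightarrow> real" where
  "combined_kernel lam \<Delta> n \<theta> r = (\<Sum>i=1..n. \<theta> i * ou_kernel lam ((real i - 1) * \<Delta>) (real i * \<Delta>) r)"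

lemma combined_kernel_nonneg:
  assumes "lam > 0" "\<Delta> > 0" "\<And>i. 0 \<le> \<theta> i"
  shows "0 \<le> combined_kernel lam \<Delta> n \<theta> r"
  unfolding combined_kernel_def
  by (intro sum_nonneg mult_nonneg_nonneg ou_kernel_nonneg) (use assms in \<open>auto simp: mult_right_mono\<close>)

lemma combined_kernel_continuous: "continuous_on S (combined_kernel lam \<Delta> n \<theta>)"
  unfolding combined_kernel_def by (intro continuous_intros ou_kernel_continuous)

text \<open>Before an interval starts, its kernel is proportional to \<open>exp r\<close>, so the weighted kernels of all later
  intervals add up to \<open>exp r\<close> times a constant, which is \<^const>\<open>s_coef\<close> up to the factor \<open>1 / lam\<close>.\<close>

lemma s_coef_eq_kernel_tail:
  assumes lam: "lam > 0" and D: "\<Delta> > 0" and "1 \<le> l" and r: "r \<le> lam * \<Delta> * (real l - 1)"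
  shows "(\<Sum>i=l..n. \<theta> i * ou_kernel lam ((real i - 1) * \<Delta>) (real i * \<Delta>) r) = exp r * s_coef lam \<Delta> n \<theta> l / lam"
proof -
  have "\<theta> i * ou_kernel lam ((real i - 1) * \<Delta>) (real i * \<Delta>) r
     = exp r * ((1 - exp (- lam * \<Delta>)) * (\<theta> i * exp (- lam * (real i - 1) * \<Delta>))) / lam" if "i \<in> {l..n}" for i
  proof -
    have "lam * \<Delta> * (real l - 1) \<le> lam * \<Delta> * (real i - 1)"
      using that lam D by (intro mult_left_mono) auto
    then have 1: "r \<le> lam * ((real i - 1) * \<Delta>)" using r by (simp add: mult_ac)
    have 2: "lam * ((real i - 1) * \<Delta>) \<le> lam * (real i * \<Delta>)"
      using lam D by (intro mult_left_mono mult_right_mono) auto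
    have "exp (- (lam * (real i * \<Delta>))) = exp (- lam * (real i - 1) * \<Delta>) * exp (- lam * \<Delta>)"
      by (simp add: exp_add[symmetric] algebra_simps)
    then show ?thesis unfolding ou_kernel_before[OF 1 2] by (simp add: algebra_simps)
  qed
  then show ?thesis
    unfolding s_coef_def by (simp add: sum_distrib_left sum_divide_distrib)
qed

text \<open>On the \<open>k\<close>-th interval the kernels of earlier intervals have died out, the current one gives the
  term with \<open>\<theta> k\<close>, and those of the later intervals sum to the term with \<^const>\<open>v_coef\<close>.\<close>

lemma combined_kernel_on_interval:
  assumes lam: "lam > 0" and D: "\<Delta> > 0" and k: "k \<in> {1..n}"
    and r: "lam * \<Delta> * (real k - 1) \<le> r" "r \<le> lam * \<Delta> * real k"
  shows "combined_kernel lam \<Delta> n \<theta> r =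
    (v_coef lam \<Delta> n \<theta> k * exp (r - lam * \<Delta> * real k) + \<theta> k * (1 - exp (r - lam * \<Delta> * real k))) / lam"
proof -
  let ?K = "\<lambda>i. \<theta> i * ou_kernel lam ((real i - 1) * \<Delta>) (real i * \<Delta>) r"
  have past: "?K i = 0" if "i \<in> {1..<k}" for i
  proof -
    have le: "real i \<le> real k - 1" using that by auto
    have "lam * \<Delta> * real i \<le> lam * \<Delta> * (real k - 1)"
      by (rule mult_left_mono[OF le]) (use lam D in simp)
    with r have "lam * (real i * \<Delta>) \<le> r" by (simp add: mult_ac)
    moreover have "lam * ((real i - 1) * \<Delta>) \<le> lam * (real i * \<Delta>)"
      using lam D by (intro mult_left_mono mult_right_mono) auto
    ultimately show ?thesis by (simp add: ou_kernel_def min_def)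
  qed
  have "{1..n} = {1..<k} \<union> ({k} \<union> {Suc k..n})" using k by auto
  then have "combined_kernel lam \<Delta> n \<theta> r = sum ?K ({1..<k} \<union> ({k} \<union> {Suc k..n}))"
    by (simp add: combined_kernel_def)
  also have "\<dots> = sum ?K {1..<k} + (?K k + sum ?K {Suc k..n})"
    by (subst sum.union_disjoint; auto)
  also have "sum ?K {1..<k} = 0" using past by (intro sum.neutral) auto
  also have "sum ?K {Suc k..n} = exp r * s_coef lam \<Delta> n \<theta> (Suc k) / lam"
    using r by (intro s_coef_eq_kernel_tail[OF lam D]) auto
  also have "exp r * s_coef lam \<Delta> n \<theta> (Suc k) = v_coef lam \<Delta> n \<theta> k * exp (r - lam * \<Delta> * real k)"
    by (simp add: v_coef_def r_coef_def mult_ac exp_diff)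
  also have "?K k = \<theta> k * (1 - exp (r - lam * \<Delta> * real k)) / lam"
    using r by (simp add: ou_kernel_def min_def mult_ac)
  finally show ?thesis by (simp add: add_divide_distrib)
qed

lemma set_integral_lborel_Ioc_split:
  fixes f :: "real \<Rightarrow> real"
  assumes "continuous_on {0..real n * a} f" "a \<ge> 0"
  shows "(LINT r:{0<..real n * a}|lborel. f r) = (\<Sum>k=1..n. LINT r:{real k * a - a..real k * a}|lborel. f r)"
  using assms(1)
proof (induction n)
  case (Suc n)
  have le: "real n * a \<le> real (Suc n) * a" "real n * a \<ge> 0" using assms(2) by (simp_all add: distrib_right)
  have int: "set_integrable lborel {0..real (Suc n) * a} f"
    unfolding set_integrable_def by (rule borel_integrable_compact[OF compact_Icc Suc.prems])
  have un: "{0<..real (Suc n) * a} = {0<..real n * a} \<union> {real n * a<..real (Suc n) * a}" using le by auto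
  have "(LINT r:{0<..real (Suc n) * a}|lborel. f r)
     = (LINT r:{0<..real n * a}|lborel. f r) + (LINT r:{real n * a<..real (Suc n) * a}|lborel. f r)"
    unfolding un by (rule set_integral_Un) (use le in \<open>auto intro!: set_integrable_subset[OF int]\<close>)
  also have "(LINT r:{0<..real n * a}|lborel. f r) = (\<Sum>k=1..n. LINT r:{real k * a - a..real k * a}|lborel. f r)"
    using le by (intro Suc.IH continuous_on_subset[OF Suc.prems]) auto
  also have "(LINT r:{real n * a<..real (Suc n) * a}|lborel. f r) = (LINT r:{real n * a..real (Suc n) * a}|lborel. f r)"
    unfolding set_lebesgue_integral_def
  proof (rule integral_cong_AE)
    have "set_integrable lborel {real n * a<..real (Suc n) * a} f" "set_integrable lborel {real n * a..real (Suc n) * a} f"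
      using le by (auto intro!: set_integrable_subset[OF int])
    then show "(\<lambda>x. indicator {real n * a<..real (Suc n) * a} x *\<^sub>R f x) \<in> borel_measurable lborel"
      "(\<lambda>x. indicator {real n * a..real (Suc n) * a} x *\<^sub>R f x) \<in> borel_measurable lborel"
      by (auto simp: set_integrable_def)
    show "AE x in lborel. indicator {real n * a<..real (Suc n) * a} x *\<^sub>R f x = indicator {real n * a..real (Suc n) * a} x *\<^sub>R f x"
      using AE_lborel_singleton[of "real n * a"] by eventually_elim (auto simp: indicator_def)
  qed
  finally show ?case by (simp add: algebra_simps)
qed (simp add: set_lebesgue_integral_def)

context stationary_subordinator_model begin

lemma weighted_variances_eq:
  assumes w: "w \<in> space M" and lam: "lam > 0" and D: "\<Delta> > 0"
  shows "(\<Sum>i=1..n. \<theta> i * actual_variance Z v0 lam \<Delta> i w)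
    = combined_kernel lam \<Delta> n \<theta> 0 * v0 w
      + (LINT r:{0<..real n * (lam * \<Delta>)}|path_measure w. combined_kernel lam \<Delta> n \<theta> r)"
proof -
  let ?L = "real n * (lam * \<Delta>)"
  let ?\<kappa> = "\<lambda>i. ou_kernel lam ((real i - 1) * \<Delta>) (real i * \<Delta>)"
  have L: "0 \<le> ?L" using lam D by simp
  have int: "set_integrable (path_measure w) {0<..?L} (?\<kappa> i)" for i
    unfolding set_integrable_def
  proof (rule Bochner_Integration.integrable_bound[where f="\<lambda>r. (1 / lam) * indicator {0<..?L} r"])
    show "integrable (path_measure w) (\<lambda>r. (1 / lam) * indicator {0<..?L} r)"
      using L w by (intro integrable_mult_right) (simp add: integrable_indicator_iff emeasure_path_measure)
    have "?\<kappa> i \<in> borel_measurable borel"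
      by (rule borel_measurable_continuous_onI[OF ou_kernel_continuous])
    then show "(\<lambda>r. indicator {0<..?L} r *\<^sub>R ?\<kappa> i r) \<in> borel_measurable (path_measure w)"
      by measurable
    have "\<bar>?\<kappa> i r\<bar> \<le> 1 / lam" for r
    proof -
      have "?\<kappa> i r \<ge> 0" using lam D by (intro ou_kernel_nonneg) (auto simp: mult_right_mono)
      moreover have "exp (min 0 (r - lam * ((real i - 1) * \<Delta>))) \<le> 1" by simp
      then have "?\<kappa> i r \<le> 1 / lam"
        unfolding ou_kernel_def using lam by (intro divide_right_mono) (auto intro: order_trans[OF _ \<open>_ \<le> 1\<close>])
      ultimately show ?thesis by simp
    qed
    then show "AE r in path_measure w. norm (indicator {0<..?L} r *\<^sub>R ?\<kappa> i r) \<le> norm (1 / lam * indicator {0<..?L} r)"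
      using lam by (intro AE_I2) (simp add: indicator_def)
  qed
  have "(\<Sum>i=1..n. \<theta> i * actual_variance Z v0 lam \<Delta> i w)
     = (\<Sum>i=1..n. \<theta> i * (?\<kappa> i 0 * v0 w + (LINT r:{0<..?L}|path_measure w. ?\<kappa> i r)))"
  proof (intro sum.cong refl arg_cong2[where f="(*)"] actual_variance_eq[OF w lam D])
    fix i assume "i \<in> {1..n}"
    then have "real i * (lam * \<Delta>) \<le> real n * (lam * \<Delta>)" using lam D by (intro mult_right_mono) auto
    then show "lam * (real i * \<Delta>) \<le> ?L" by (simp add: mult_ac)
  qed auto
  also have "\<dots> = combined_kernel lam \<Delta> n \<theta> 0 * v0 w + (\<Sum>i=1..n. LINT r:{0<..?L}|path_measure w. \<theta> i * ?\<kappa> i r)"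
    by (simp add: combined_kernel_def sum.distrib distrib_left sum_distrib_right mult.assoc)
  also have "(\<Sum>i=1..n. LINT r:{0<..?L}|path_measure w. \<theta> i * ?\<kappa> i r)
     = (LINT r:{0<..?L}|path_measure w. combined_kernel lam \<Delta> n \<theta> r)"
  proof -
    have "integrable (path_measure w) (\<lambda>r. indicator {0<..?L} r *\<^sub>R (\<theta> i * ?\<kappa> i r))" for i
      using integrable_mult_right[OF int[of i, unfolded set_integrable_def], of "\<theta> i"] by (simp add: mult_ac)
    then show ?thesis
      unfolding set_lebesgue_integral_def combined_kernel_def
      by (subst Bochner_Integration.integral_sum[symmetric]) (auto simp: sum_distrib_left)
  qed
  finally show ?thesis .
qed

text \<open>The exponential formula with \<open>h = combined_kernel\<close>, where the exponent splits over the sampling intervals. The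
  last interval has \<open>v_n = 0\<close> because nothing follows it, which turns \<^const>\<open>Phi_cond\<close> into \<^const>\<open>Phi_last\<close>.\<close>

lemma joint_laplace_actual_variances:
  assumes lam: "lam > 0" and D: "\<Delta> > 0" and n: "n \<ge> 1" and \<theta>: "\<And>i. 0 \<le> \<theta> i"
  shows "joint_laplace M (actual_variance Z v0 lam \<Delta>) n \<theta> = L1_form (levy_psi \<rho>) lam \<Delta> n \<theta>"
    and "varphi (levy_psi \<rho>) lam (s_coef lam \<Delta> n \<theta> 1) = levy_exponent M v0 (s_coef lam \<Delta> n \<theta> 1 / lam)"
proof -
  let ?L = "real n * (lam * \<Delta>)" and ?h = "combined_kernel lam \<Delta> n \<theta>" and ?a = "lam * \<Delta>"
  let ?\<psi> = "levy_psi \<rho>"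
  have L: "0 < ?L" using lam D n by simp
  note h_nonneg = combined_kernel_nonneg[OF lam D, of \<theta> n, OF \<theta>]
  have h0: "?h 0 = s_coef lam \<Delta> n \<theta> 1 / lam"
    using s_coef_eq_kernel_tail[OF lam D, of 1 0 \<theta> n] by (simp add: combined_kernel_def)
  show vp: "varphi ?\<psi> lam (s_coef lam \<Delta> n \<theta> 1) = levy_exponent M v0 (s_coef lam \<Delta> n \<theta> 1 / lam)"
    using levy_exponent_v0(1)[OF h_nonneg[of 0]] by (simp add: varphi_def h0)
  have s_nonneg: "0 \<le> s_coef lam \<Delta> n \<theta> l" for l
    unfolding s_coef_def using lam D \<theta> by (intro mult_nonneg_nonneg sum_nonneg) auto
  have psi_cont: "continuous_on {0..} ?\<psi>" by (rule levy_psi_continuous[OF levy_measure])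
  have cell: "(LINT r:{real k * ?a - ?a..real k * ?a}|lborel. ?\<psi> (?h r)) = Phi_cond ?\<psi> lam ?a (\<theta> k) (v_coef lam \<Delta> n \<theta> k)"
    if k: "k \<in> {1..n}" for k
  proof -
    have v: "0 \<le> v_coef lam \<Delta> n \<theta> k" using s_nonneg by (simp add: v_coef_def r_coef_def)
    have a0: "0 \<le> ?a" using lam D by simp
    show ?thesis
      unfolding Phi_cond_eq_path_integral[OF psi_cont lam a0 \<theta> v, of k "real k * ?a"]
      by (intro set_lebesgue_integral_cong ballI refl allI impI arg_cong[where f="?\<psi>"])
         (use combined_kernel_on_interval[OF lam D k, of _ \<theta>] in \<open>auto simp: algebra_simps\<close>)
  qed
  have "(LINT r:{0<..?L}|lborel. ?\<psi> (?h r)) = (\<Sum>k=1..n. LINT r:{real k * ?a - ?a..real k * ?a}|lborel. ?\<psi> (?h r))"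
  proof (rule set_integral_lborel_Ioc_split)
    show "continuous_on {0..?L} (\<lambda>r. ?\<psi> (?h r))"
      by (rule continuous_on_compose2[OF psi_cont combined_kernel_continuous]) (use h_nonneg in auto)
  qed (use lam D in simp)
  also have "\<dots> = (\<Sum>k=1..n. Phi_cond ?\<psi> lam ?a (\<theta> k) (v_coef lam \<Delta> n \<theta> k))"
    by (intro sum.cong refl cell)
  also have "\<dots> = (\<Sum>k=1..n - 1. Phi_cond ?\<psi> lam ?a (\<theta> k) (v_coef lam \<Delta> n \<theta> k)) + Phi_last ?\<psi> lam ?a (\<theta> n)"
  proof -
    have "{1..n} = insert n {1..n - 1}" using n by auto
    moreover have "v_coef lam \<Delta> n \<theta> n = 0" by (simp add: v_coef_def s_coef_def)
    ultimately show ?thesis using n by (simp add: Phi_cond_def Phi_last_def)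
  qed
  finally have int_eq: "(LINT r:{0<..?L}|lborel. ?\<psi> (?h r))
    = (\<Sum>k=1..n - 1. Phi_cond ?\<psi> lam ?a (\<theta> k) (v_coef lam \<Delta> n \<theta> k)) + Phi_last ?\<psi> lam ?a (\<theta> n)" .
  have "joint_laplace M (actual_variance Z v0 lam \<Delta>) n \<theta>
     = (LINT w|M. exp (- (?h 0 * v0 w + (LINT r:{0<..?L}|path_measure w. ?h r))))"
    unfolding joint_laplace_def
    by (intro Bochner_Integration.integral_cong refl) (simp only: weighted_variances_eq[OF _ lam D])
  also have "\<dots> = exp (- levy_exponent M v0 (?h 0)) * exp (- (LINT r:{0<..?L}|lborel. ?\<psi> (?h r)))"
    by (rule laplace_path_integral[OF h_nonneg L combined_kernel_continuous h_nonneg])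
  also have "\<dots> = L1_form ?\<psi> lam \<Delta> n \<theta>"
    unfolding int_eq h0 L1_form_def vp
    by (simp only: minus_add_distrib exp_add sum_negf[symmetric] exp_sum[OF finite_atLeastAtMost] mult_ac)
  finally show "joint_laplace M (actual_variance Z v0 lam \<Delta>) n \<theta> = L1_form ?\<psi> lam \<Delta> n \<theta>" .
qed

lemma actual_variance_measurable:
  assumes "lam > 0" "\<Delta> > 0" "1 \<le> i"
  shows "actual_variance Z v0 lam \<Delta> i \<in> borel_measurable M"
proof -
  let ?\<kappa> = "ou_kernel lam ((real i - 1) * \<Delta>) (real i * \<Delta>)" and ?L = "lam * (real i * \<Delta>)"
  have L: "?L > 0" using assms by simp
  note [measurable] = path_integral_measurable[OF ou_kernel_continuous L, of lam "(real i - 1) * \<Delta>" "real i * \<Delta>"]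
  have "(\<lambda>w. ?\<kappa> 0 * v0 w + (LINT r:{0<..?L}|path_measure w. ?\<kappa> r)) \<in> borel_measurable M"
    by measurable
  then show ?thesis
    by (rule measurable_cong[THEN iffD1, rotated]) (use actual_variance_eq[OF _ assms, of _ ?L] in simp)
qed

lemma actual_variance_ge_v0:
  assumes "w \<in> space M" "lam > 0" "\<Delta> > 0" "1 \<le> i"
  shows "actual_variance Z v0 lam \<Delta> i w \<ge> ou_kernel lam ((real i - 1) * \<Delta>) (real i * \<Delta>) 0 * v0 w"
proof -
  have "0 \<le> (LINT r:{0<..lam * (real i * \<Delta>)}|path_measure w. ou_kernel lam ((real i - 1) * \<Delta>) (real i * \<Delta>) r)"
    unfolding set_lebesgue_integral_def using assms
    by (intro integral_nonneg_AE AE_I2) (auto simp: indicator_def mult_right_mono intro!: ou_kernel_nonneg)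
  then show ?thesis using actual_variance_eq[OF assms order_refl] by simp
qed

lemma actual_variance_nonneg:
  assumes "lam > 0" "\<Delta> > 0" "1 \<le> i"
  shows "AE w in M. 0 \<le> actual_variance Z v0 lam \<Delta> i w"
  using v0_nonneg AE_space
proof eventually_elim
  fix w assume "0 \<le> v0 w" "w \<in> space M"
  moreover have "0 \<le> ou_kernel lam ((real i - 1) * \<Delta>) (real i * \<Delta>) 0"
    using assms by (intro ou_kernel_nonneg) (auto simp: mult_right_mono)
  ultimately show "0 \<le> actual_variance Z v0 lam \<Delta> i w"
    using actual_variance_ge_v0[OF _ assms, of w] by (meson mult_nonneg_nonneg order_trans)
qed

text \<open>Since \<open>\<psi>\<close> is increasing with \<open>\<psi> 1 > 0\<close>, the Levy exponent of \<open>v0\<close> at \<open>\<theta> > 1\<close> is at least the integral of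
  \<open>\<psi> 1 / u\<close> over \<open>{1 / \<theta>..1}\<close>, that is \<open>\<psi> 1 * ln \<theta>\<close>. The Laplace transform of \<open>v0\<close>, which dominates the
  mass at 0, therefore tends to 0.\<close>

lemma v0_pos:
  assumes "emeasure \<rho> {0<..} \<noteq> 0"
  shows "AE w in M. 0 < v0 w"
proof -
  let ?p = "levy_psi \<rho> 1"
  have p: "0 < ?p" by (rule levy_psi_pos[OF levy_measure assms])
  have lower: "?p * ln \<theta> \<le> levy_exponent M v0 \<theta>" if "\<theta> > 1" for \<theta>
  proof -
    have pos: "0 < u" if "1 / \<theta> \<le> u" for u
      using that \<open>\<theta> > 1\<close> by (meson less_le_trans zero_less_divide_1_iff zero_less_one less_trans)
    have "(LINT u|lborel. indicator {1 / \<theta>..1} u *\<^sub>R (?p / u)) = ?p * ln 1 - ?p * ln (1 / \<theta>)"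
      by (rule integral_FTC_Icc)
         (use that in \<open>auto intro!: derivative_eq_intros continuous_intros dest!: pos
          simp: has_real_derivative_iff_has_vector_derivative[symmetric]\<close>)
    then have "?p * ln \<theta> = (LINT u:{1 / \<theta>..1}|lborel. ?p / u)"
      using that by (simp add: set_lebesgue_integral_def ln_div)
    also have "\<dots> \<le> (LINT u:{0<..1}|lborel. levy_psi \<rho> (\<theta> * u) / u)"
      unfolding set_lebesgue_integral_def
    proof (rule integral_mono)
      show "integrable lborel (\<lambda>u. indicator {1 / \<theta>..1} u *\<^sub>R (?p / u))"
        by (rule borel_integrable_compact) (use that in \<open>auto intro!: continuous_intros\<close>)
      show "integrable lborel (\<lambda>u. indicator {0<..1} u *\<^sub>R (levy_psi \<rho> (\<theta> * u) / u))"
        using levy_exponent_v0(2)[of \<theta>] that by (simp add: set_integrable_def)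
      fix u :: real
      show "indicator {1 / \<theta>..1} u *\<^sub>R (?p / u) \<le> indicator {0<..1} u *\<^sub>R (levy_psi \<rho> (\<theta> * u) / u)"
      proof (cases "u \<in> {1 / \<theta>..1}")
        case True
        then have u: "0 < u" "1 \<le> \<theta> * u"
          using pos[of u] that by (auto simp: divide_le_eq mult.commute)
        then show ?thesis using True levy_psi_mono[OF levy_measure _ u(2)] by (simp add: divide_right_mono)
      next
        case False
        then show ?thesis using levy_psi_nonneg[of "\<theta> * u" \<rho>] that by (simp add: indicator_def)
      qed
    qed
    also have "\<dots> = levy_exponent M v0 \<theta>" using levy_exponent_v0(1)[of \<theta>] that by simp
    finally show ?thesis .
  qed
  have z [measurable]: "{w \<in> space M. v0 w \<le> 0} \<in> sets M" by measurable
  have upper: "prob {w \<in> space M. v0 w \<le> 0} \<le> exp (- (?p * ln \<theta>))" if "\<theta> > 1" for \<theta>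
  proof -
    have "prob {w \<in> space M. v0 w \<le> 0} = (LINT w|M. indicator {w \<in> space M. v0 w \<le> 0} w)"
      by simp
    also have "\<dots> \<le> (LINT w|M. exp (- (\<theta> * v0 w)))"
    proof (rule integral_mono)
      show "integrable M (indicator {w \<in> space M. v0 w \<le> 0} :: 'w \<Rightarrow> real)"
        by (intro integrable_real_indicator z) (simp add: emeasure_eq_measure)
      show "integrable M (\<lambda>w. exp (- (\<theta> * v0 w)))" using that by (intro integrable_exp_v0) simp
      show "indicator {w \<in> space M. v0 w \<le> 0} w \<le> exp (- (\<theta> * v0 w))" for w
        using that by (auto simp: indicator_def mult_nonneg_nonpos)
    qed
    also have "\<dots> = exp (- levy_exponent M v0 \<theta>)" using that by (intro laplace_v0) simp
    also have "\<dots> \<le> exp (- (?p * ln \<theta>))" using lower[OF that] by simp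
    finally show ?thesis .
  qed
  have "((\<lambda>\<theta>. exp (- (?p * ln \<theta>))) \<longlongrightarrow> 0) at_top"
    by (rule filterlim_compose[OF exp_at_bot])
       (use p in \<open>auto simp: filterlim_uminus_at_bot intro!: filterlim_tendsto_pos_mult_at_top[OF tendsto_const] ln_at_top\<close>)
  moreover have "\<forall>\<^sub>F \<theta> in at_top. prob {w \<in> space M. v0 w \<le> 0} \<le> exp (- (?p * ln \<theta>))"
    using eventually_gt_at_top[of "1::real"] by eventually_elim (rule upper)
  ultimately have "prob {w \<in> space M. v0 w \<le> 0} \<le> 0"
    by (rule tendsto_lowerbound) simp
  then have "prob {w \<in> space M. v0 w \<le> 0} = 0" by (simp add: measure_le_0_iff)
  then have "AE w in M. w \<notin> {w \<in> space M. v0 w \<le> 0}"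
    by (simp only: prob_eq_0[OF z])
  then show ?thesis using AE_space by eventually_elim auto
qed

lemma actual_variance_pos:
  assumes "lam > 0" "\<Delta> > 0" "1 \<le> i" and \<rho>: "emeasure \<rho> {0<..} \<noteq> 0"
  shows "AE w in M. 0 < actual_variance Z v0 lam \<Delta> i w"
  using v0_pos[OF \<rho>] AE_space
proof eventually_elim
  fix w assume "0 < v0 w" "w \<in> space M"
  have "lam * ((real i - 1) * \<Delta>) < lam * (real i * \<Delta>)" "0 \<le> lam * ((real i - 1) * \<Delta>)"
    using assms by simp_all
  then have "0 < ou_kernel lam ((real i - 1) * \<Delta>) (real i * \<Delta>) 0"
    using assms(1) by (subst ou_kernel_before) auto
  with \<open>0 < v0 w\<close> show "0 < actual_variance Z v0 lam \<Delta> i w"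
    using actual_variance_ge_v0[OF \<open>w \<in> space M\<close> assms(1-3)] by (meson mult_pos_pos less_le_trans)
qed

end

section \<open>Normal densities as cosine transforms\<close>

text \<open>The real part of the characteristic function of the standard Normal law.\<close>

lemma has_bochner_integral_cos_std_normal:
  "has_bochner_integral lborel (\<lambda>x. cos (t * x) * std_normal_density x) (exp (- t\<^sup>2 / 2))"
proof -
  have int: "integrable lborel (\<lambda>x. cos (t * x) * std_normal_density x)"
    by (rule Bochner_Integration.integrable_bound[OF integrable_normal_density[of 1 0]])
       (auto intro!: AE_I2 mult_left_le_one_le simp: abs_mult)
  interpret P: prob_space std_normal_distribution by (rule prob_space_normal_density) simp
  have i: "integrable std_normal_distribution (\<lambda>x. iexp (t * x))"
    by (rule P.integrable_iexp) auto
  have "exp (- t\<^sup>2 / 2) = Re (char std_normal_distribution t)"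
    by (simp add: char_std_normal_distribution)
  also have "\<dots> = (LINT x|std_normal_distribution. Re (iexp (t * x)))"
    unfolding char_def using integral_Re[OF i] by simp
  also have "\<dots> = (LINT x|std_normal_distribution. cos (t * x))"
    by (simp add: Re_exp)
  also have "\<dots> = (LINT x|lborel. std_normal_density x * cos (t * x))"
    by (subst integral_density) auto
  finally show ?thesis using int by (simp add: has_bochner_integral_iff mult.commute)
qed

lemma has_bochner_integral_even_half:
  fixes f :: "real \<Rightarrow> real"
  assumes "has_bochner_integral lborel f c" "\<And>x. f (- x) = f x"
  shows "has_bochner_integral lborel (\<lambda>x. indicator {0..} x * f x) (c / 2)"
proof -
  have int: "integrable lborel f" and c: "integral\<^sup>L lborel f = c"
    using assms(1) by (auto simp: has_bochner_integral_iff)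
  have i1: "integrable lborel (\<lambda>x. indicator {0..} x * f x)" (is "integrable _ ?g")
    and i2: "integrable lborel (\<lambda>x. indicator {..0} x * f x)" (is "integrable _ ?h")
    using integrable_mult_indicator[OF _ int, of "{0..}"] integrable_mult_indicator[OF _ int, of "{..0}"]
    by auto
  have "integral\<^sup>L lborel ?g = integral\<^sup>L lborel ?h"
    by (subst lborel_integral_real_affine[of "-1" _ 0])
       (auto simp: assms(2) indicator_def intro!: Bochner_Integration.integral_cong)
  moreover have "integral\<^sup>L lborel ?g + integral\<^sup>L lborel ?h = c"
    unfolding c[symmetric] Bochner_Integration.integral_add[OF i1 i2, symmetric]
    by (rule integral_cong_AE) (use AE_lborel_singleton[of "0::real"] int in
        \<open>auto simp: indicator_def elim!: eventually_mono\<close>)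
  ultimately show ?thesis using i1 by (simp add: has_bochner_integral_iff)
qed

lemma gaussian_cosine_integral:
  fixes t a :: real
  assumes "t > 0"
  shows "has_bochner_integral lborel
    (\<lambda>y. indicator {0..} y * (cos (y * a) * exp (- (y\<^sup>2 / 2 * t))))
    (pi * exp (- a\<^sup>2 / (2 * t)) / sqrt (2 * pi * t))"
proof -
  define b where "b = a / sqrt t"
  have "has_bochner_integral lborel (\<lambda>x. cos (b * (sqrt t * x)) * std_normal_density (sqrt t * x))
     (exp (- b\<^sup>2 / 2) / sqrt t)"
  proof -
    have "has_bochner_integral lborel (\<lambda>x. cos (b * (0 + sqrt t * x)) * std_normal_density (0 + sqrt t * x))
       (exp (- b\<^sup>2 / 2) /\<^sub>R \<bar>sqrt t\<bar>)"
      using assms by (intro iffD1[OF lborel_has_bochner_integral_real_affine_iff] has_bochner_integral_cos_std_normal) simp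
    then show ?thesis
      using assms by (simp only: add_0 abs_of_pos real_sqrt_gt_zero real_scaleR_def divide_inverse mult.commute[of "inverse (sqrt t)"])
  qed
  then have "has_bochner_integral lborel (\<lambda>x. sqrt (2 * pi) *
       (cos (b * (sqrt t * x)) * std_normal_density (sqrt t * x)))
     (sqrt (2 * pi) * (exp (- b\<^sup>2 / 2) / sqrt t))"
    by (rule has_bochner_integral_mult_right)
  also have "(\<lambda>x. sqrt (2 * pi) * (cos (b * (sqrt t * x)) * std_normal_density (sqrt t * x)))
     = (\<lambda>y. cos (y * a) * exp (- (y\<^sup>2 / 2 * t)))"
    using assms by (auto simp: std_normal_density_def b_def power_mult_distrib mult_ac)
  finally have "has_bochner_integral lborel (\<lambda>y. indicator {0..} y * (cos (y * a) * exp (- (y\<^sup>2 / 2 * t))))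
     (sqrt (2 * pi) * (exp (- b\<^sup>2 / 2) / sqrt t) / 2)"
    by (rule has_bochner_integral_even_half) simp
  also have "sqrt (2 * pi) * (exp (- b\<^sup>2 / 2) / sqrt t) / 2 = pi * exp (- a\<^sup>2 / (2 * t)) / sqrt (2 * pi * t)"
  proof -
    have b: "- b\<^sup>2 / 2 = - a\<^sup>2 / (2 * t)" using assms by (simp add: b_def power_divide)
    have s: "sqrt (2 * pi) / 2 = pi / sqrt (2 * pi)"
      by (simp add: field_simps)
    have "sqrt (2 * pi) * (exp (- b\<^sup>2 / 2) / sqrt t) / 2 = sqrt (2 * pi) / 2 * (exp (- a\<^sup>2 / (2 * t)) / sqrt t)"
      unfolding b by simp
    also have "\<dots> = pi * exp (- a\<^sup>2 / (2 * t)) / sqrt (2 * pi * t)"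
      unfolding s real_sqrt_mult[of "2 * pi" t] by simp
    finally show ?thesis .
  qed
  finally show ?thesis .
qed

text \<open>By \<open>2 * cos\<^sup>2 z = 1 + cos (2 * z)\<close>, twice the right-hand integral exceeds the left-hand one by the
  cosine transform of a Gaussian, which is positive. For \<open>t = 0\<close> both sides are infinite; the
  right-hand one by comparison with \<open>t > 0\<close> and letting \<open>t\<close> tend to 0.\<close>

lemma gaussian_mass_le_cos_square:
  fixes t a b :: real
  assumes "t \<ge> 0"
  shows "(\<integral>\<^sup>+y. ennreal (indicator {0..} y * exp (- ((y\<^sup>2 / 2 + b\<^sup>2 / 2) * t))) \<partial>lborel)
    \<le> 2 * (\<integral>\<^sup>+y. ennreal (indicator {0..} y * ((cos (y * a))\<^sup>2 * exp (- ((y\<^sup>2 / 2 + b\<^sup>2 / 2) * t)))) \<partial>lborel)"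
    (is "?L t \<le> 2 * ?R t")
    and "t = 0 \<Longrightarrow> (\<integral>\<^sup>+y. ennreal (indicator {0..} y * ((cos (y * a))\<^sup>2 * exp (- ((y\<^sup>2 / 2 + b\<^sup>2 / 2) * t)))) \<partial>lborel) = \<infinity>"
proof -
  have fin: "?L t = ennreal (pi / sqrt (2 * pi * t) * exp (- (b\<^sup>2 / 2 * t)))"
    and le: "?L t \<le> 2 * ?R t" if "t > 0" for t
  proof -
    let ?e = "exp (- (b\<^sup>2 / 2 * t))"
    have e: "exp (- ((y\<^sup>2 / 2 + b\<^sup>2 / 2) * t)) = ?e * exp (- (y\<^sup>2 / 2 * t))" for y :: real
      by (simp add: algebra_simps flip: exp_add)
    have h0: "has_bochner_integral lborel (\<lambda>y. ?e * (indicator {0..} y * (cos (y * 0) * exp (- (y\<^sup>2 / 2 * t)))))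
       (?e * (pi * exp (- 0\<^sup>2 / (2 * t)) / sqrt (2 * pi * t)))"
      by (intro has_bochner_integral_mult_right gaussian_cosine_integral that)
    also have "(\<lambda>y. ?e * (indicator {0..} y * (cos (y * 0) * exp (- (y\<^sup>2 / 2 * t)))))
       = (\<lambda>y. indicator {0..} y * exp (- ((y\<^sup>2 / 2 + b\<^sup>2 / 2) * t)))"
      unfolding e by (simp add: mult_ac)
    also have "?e * (pi * exp (- 0\<^sup>2 / (2 * t)) / sqrt (2 * pi * t)) = pi / sqrt (2 * pi * t) * ?e"
      by simp
    finally have h0: "has_bochner_integral lborel (\<lambda>y. indicator {0..} y * exp (- ((y\<^sup>2 / 2 + b\<^sup>2 / 2) * t)))
       (pi / sqrt (2 * pi * t) * ?e)" .
    (* Frequency 0 gives the Gaussian mass, frequency 2 * a the correction from doubling the angle. *)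
    have h1: "has_bochner_integral lborel (\<lambda>y. ?e * (indicator {0..} y * (cos (y * (2 * a)) * exp (- (y\<^sup>2 / 2 * t)))))
       (?e * (pi * exp (- (2 * a)\<^sup>2 / (2 * t)) / sqrt (2 * pi * t)))"
      by (intro has_bochner_integral_mult_right gaussian_cosine_integral that)
    define c where "c = ?e * (pi * exp (- (2 * a)\<^sup>2 / (2 * t)) / sqrt (2 * pi * t))"
    have c: "c \<ge> 0" using that by (simp add: c_def)
    have "has_bochner_integral lborel (\<lambda>y. 1 / 2 * (indicator {0..} y * exp (- ((y\<^sup>2 / 2 + b\<^sup>2 / 2) * t))
       + ?e * (indicator {0..} y * (cos (y * (2 * a)) * exp (- (y\<^sup>2 / 2 * t))))))
       (1 / 2 * (pi / sqrt (2 * pi * t) * ?e + c))"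
      unfolding c_def by (intro has_bochner_integral_mult_right has_bochner_integral_add h0 h1)
    also have "(\<lambda>y. 1 / 2 * (indicator {0..} y * exp (- ((y\<^sup>2 / 2 + b\<^sup>2 / 2) * t))
       + ?e * (indicator {0..} y * (cos (y * (2 * a)) * exp (- (y\<^sup>2 / 2 * t))))))
       = (\<lambda>y. indicator {0..} y * ((cos (y * a))\<^sup>2 * exp (- ((y\<^sup>2 / 2 + b\<^sup>2 / 2) * t))))"
    proof
      fix y
      have "cos (y * (2 * a)) = 2 * (cos (y * a))\<^sup>2 - 1"
        using cos_double_cos[of "y * a"] by (simp add: mult_ac)
      then show "1 / 2 * (indicator {0..} y * exp (- ((y\<^sup>2 / 2 + b\<^sup>2 / 2) * t))
       + ?e * (indicator {0..} y * (cos (y * (2 * a)) * exp (- (y\<^sup>2 / 2 * t)))))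
       = indicator {0..} y * ((cos (y * a))\<^sup>2 * exp (- ((y\<^sup>2 / 2 + b\<^sup>2 / 2) * t)))"
        unfolding e by (simp only:) (simp add: algebra_simps)
    qed
    finally have h2: "has_bochner_integral lborel (\<lambda>y. indicator {0..} y * ((cos (y * a))\<^sup>2 * exp (- ((y\<^sup>2 / 2 + b\<^sup>2 / 2) * t))))
      (1 / 2 * (pi / sqrt (2 * pi * t) * ?e + c))" .
    show L: "?L t = ennreal (pi / sqrt (2 * pi * t) * ?e)"
      using h0 by (subst nn_integral_eq_integral) (auto simp: has_bochner_integral_iff)
    have R: "?R t = ennreal (1 / 2 * (pi / sqrt (2 * pi * t) * ?e + c))"
      unfolding has_bochner_integral_integral_eq[OF h2, symmetric]
      by (rule nn_integral_eq_integral) (use h2 in \<open>auto simp: has_bochner_integral_iff\<close>)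
    have "2 * ?R t = ennreal (pi / sqrt (2 * pi * t) * ?e + c)"
    proof -
      have "2 * ennreal x = ennreal (2 * x)" for x by (simp add: ennreal_mult')
      moreover have "2 * (1 / 2 * x) = x" for x :: real by simp
      ultimately show ?thesis unfolding R by (simp only:)
    qed
    then show "?L t \<le> 2 * ?R t" unfolding L using c by (simp add: ennreal_leI)
  qed
  have inf: "?R 0 = \<infinity>"
  proof (rule ccontr)
    assume "?R 0 \<noteq> \<infinity>"
    then obtain r where r: "?R 0 = ennreal r" "r \<ge> 0" by (cases "?R 0") auto
    have "?R t \<le> ?R 0" if "t > 0" for t
      using that by (intro nn_integral_mono ennreal_leI mult_left_mono) auto
    then have *: "?L t \<le> 2 * ?R 0" if "t > 0" for t
      using le[OF that] that by (meson dual_order.trans mult_left_mono zero_le)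
    have "pi / sqrt (2 * pi * t) * exp (- (b\<^sup>2 / 2 * t)) \<le> 2 * r" if "t > 0" for t
    proof -
      have "ennreal (pi / sqrt (2 * pi * t) * exp (- (b\<^sup>2 / 2 * t))) \<le> ennreal (2 * r)"
        using *[OF that] r unfolding fin[OF that] by (simp add: ennreal_mult')
      then show ?thesis using r by (subst (asm) ennreal_le_iff) auto
    qed
    then have ev: "\<forall>\<^sub>F t in at_right 0. pi / sqrt (2 * pi * t) * exp (- (b\<^sup>2 / 2 * t)) \<le> 2 * r"
      by (auto simp: eventually_at_right_less intro: eventually_at_rightI[of 0 1])
    have "filterlim (\<lambda>t. pi * exp (- (b\<^sup>2 / 2 * t)) / sqrt (2 * pi * t)) at_top (at_right 0)"
    proof (rule LIM_at_top_divide)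
      show "((\<lambda>t. pi * exp (- (b\<^sup>2 / 2 * t))) \<longlongrightarrow> pi * exp (- (b\<^sup>2 / 2 * 0))) (at_right 0)"
        by (intro tendsto_intros)
      have "((\<lambda>t. sqrt (2 * pi * t)) \<longlongrightarrow> sqrt (2 * pi * 0)) (at_right 0)"
        by (intro tendsto_intros)
      then show "((\<lambda>t. sqrt (2 * pi * t)) \<longlongrightarrow> 0) (at_right 0)" by simp
      show "\<forall>\<^sub>F t in at_right 0. 0 < sqrt (2 * pi * t)"
        by (auto simp: eventually_at_right_less intro: eventually_at_rightI[of 0 1])
    qed auto
    also have "(\<lambda>t. pi * exp (- (b\<^sup>2 / 2 * t)) / sqrt (2 * pi * t))
      = (\<lambda>t. pi / sqrt (2 * pi * t) * exp (- (b\<^sup>2 / 2 * t)))"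
      by simp
    finally have "\<forall>\<^sub>F t in at_right 0. pi / sqrt (2 * pi * t) * exp (- (b\<^sup>2 / 2 * t)) > 2 * r"
      by (auto simp: filterlim_at_top_dense)
    from eventually_conj[OF this ev] have "\<forall>\<^sub>F t in at_right (0::real). False" by (rule eventually_mono) auto
    then show False by simp
  qed
  show "?L t \<le> 2 * ?R t" 
    by (cases "t = 0") (use inf le assms in \<open>auto simp: ennreal_mult_eq_top_iff\<close>)
  show "?R t = \<infinity>" if "t = 0" using inf that by simp
qed

lemma cosine_not_integrable:
  fixes a :: real
  shows   "\<not> integrable lborel (\<lambda>y. indicator {0..} y * cos (y * a))"
proof
  assume i: "integrable lborel (\<lambda>y::real. indicator {0..} y * cos (y * a))"
  have "(\<integral>\<^sup>+y. ennreal (indicator {0..} y * ((cos (y * a))\<^sup>2 * exp (- ((y\<^sup>2 / 2 + 0\<^sup>2 / 2) * 0)))) \<partial>lborel)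
    \<le> (\<integral>\<^sup>+y. ennreal (norm (indicator {0..} y * cos (y * a))) \<partial>lborel)"
  proof (intro nn_integral_mono ennreal_leI)
    fix y
    have "(cos (y * a))\<^sup>2 \<le> \<bar>cos (y * a)\<bar>"
      using abs_cos_le_one[of "y * a"] mult_left_le_one_le[of "\<bar>cos (y * a)\<bar>" "\<bar>cos (y * a)\<bar>"]
      by (simp add: power2_eq_square)
    then show "indicator {0..} y * ((cos (y * a))\<^sup>2 * exp (- ((y\<^sup>2 / 2 + 0\<^sup>2 / 2) * 0)))
      \<le> norm (indicator {0..} y * cos (y * a))"
      by (simp add: indicator_def)
  qed
  also have "\<dots> < \<infinity>" using i by (simp add: integrable_iff_bounded)
  finally show False using gaussian_mass_le_cos_square(2)[of 0 a 0] by simp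
qed

text \<open>For \<open>t = 0\<close> both sides are 0 by convention: the cosine is not integrable over the half-line, and
  a Normal density with standard deviation 0 contains a division by 0. The identity therefore extends
  to vanishing variances.\<close>

lemma normal_density_cosine_integral:
  fixes t m x b :: real
  assumes "t \<ge> 0"
  shows "(LINT y|lborel. indicator {0..} y * (cos (y * \<bar>x - m\<bar>) * exp (- ((y\<^sup>2 / 2 + b\<^sup>2 / 2) * t))))
    = pi * exp (- ((x - m) * b)) * normal_density (m + b * t) (sqrt t) x"
proof (cases "t = 0")
  case True
  then show ?thesis
    using cosine_not_integrable[of "\<bar>x - m\<bar>"] by (simp add: not_integrable_integral_eq normal_density_def)
next
  case False
  with assms have t: "t > 0" by simp
  let ?A = "x - m"
  have e: "exp (- ((y\<^sup>2 / 2 + b\<^sup>2 / 2) * t)) = exp (- (b\<^sup>2 / 2 * t)) * exp (- (y\<^sup>2 / 2 * t))" for y :: real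
    by (simp add: algebra_simps flip: exp_add)
  have "(LINT y|lborel. indicator {0..} y * (cos (y * \<bar>?A\<bar>) * exp (- ((y\<^sup>2 / 2 + b\<^sup>2 / 2) * t))))
    = (LINT y|lborel. exp (- (b\<^sup>2 / 2 * t)) * (indicator {0..} y * (cos (y * \<bar>?A\<bar>) * exp (- (y\<^sup>2 / 2 * t)))))"
    unfolding e by (simp add: mult_ac)
  also have "\<dots> = exp (- (b\<^sup>2 / 2 * t)) * (pi * exp (- ?A\<^sup>2 / (2 * t)) / sqrt (2 * pi * t))"
    using has_bochner_integral_mult_right[OF gaussian_cosine_integral[OF t, of "\<bar>?A\<bar>"]]
    by (simp add: has_bochner_integral_iff)
  also have "\<dots> = pi / sqrt (2 * pi * t) * exp (- (b\<^sup>2 / 2 * t) + - ?A\<^sup>2 / (2 * t))"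
    by (simp only: exp_add) simp
  also have "- (b\<^sup>2 / 2 * t) + - ?A\<^sup>2 / (2 * t) = - (?A * b) + - (x - (m + b * t))\<^sup>2 / (2 * t)"
    using t by (simp add: field_simps power2_eq_square)
  also have "pi / sqrt (2 * pi * t) * exp \<dots> = pi * exp (- (?A * b)) * normal_density (m + b * t) (sqrt t) x"
    unfolding exp_add using t by (simp add: normal_density_def)
  finally show ?thesis .
qed

text \<open>Integration by parts: the boundary term is at most \<open>q R / a\<close> in absolute value, where \<open>q\<close> is the damping factor, and the
  remaining integral is at most \<open>(q 0 - q R) / a\<close> because \<open>q\<close> is decreasing. The two add up to
  \<open>q 0 / a\<close>, independently of \<open>R\<close>.\<close>

lemma damped_cosine_bound:
  fixes t a R :: real
  assumes "t \<ge> 0" "a > 0"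
  shows "\<bar>LINT y|lborel. indicator {0..R} y * (cos (y * a) * exp (- ((y\<^sup>2 / 2 + b\<^sup>2 / 2) * t)))\<bar> \<le> 1 / a"
proof (cases "R \<ge> 0")
  case False
  then show ?thesis using assms by simp
next
  case True
  let ?q = "\<lambda>y::real. exp (- ((y\<^sup>2 / 2 + b\<^sup>2 / 2) * t))"
  (* c1 integrates the derivative of sin (y * a) / a * ?q y, and c2 that of - ?q y / a. *)
  have c1: "(LINT y|lborel. indicator {0..R} y *\<^sub>R (cos (y * a) * ?q y - sin (y * a) / a * (y * t * ?q y)))
      = sin (R * a) / a * ?q R - sin (0 * a) / a * ?q 0"
    by (rule integral_FTC_Icc[OF True])
       (use assms in \<open>auto intro!: derivative_eq_intros continuous_intros
          simp: has_real_derivative_iff_has_vector_derivative[symmetric] field_simps\<close>)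
  have c2: "(LINT y|lborel. indicator {0..R} y *\<^sub>R (1 / a * (y * t * ?q y))) = - (1 / a * ?q R) - - (1 / a * ?q 0)"
    by (rule integral_FTC_Icc[OF True])
       (use assms in \<open>auto intro!: derivative_eq_intros continuous_intros simp: has_real_derivative_iff_has_vector_derivative[symmetric]\<close>)
  have i1: "integrable lborel (\<lambda>y. indicator {0..R} y *\<^sub>R (cos (y * a) * ?q y))"
    and i2: "integrable lborel (\<lambda>y. indicator {0..R} y *\<^sub>R (sin (y * a) / a * (y * t * ?q y)))"
    and i3: "integrable lborel (\<lambda>y. indicator {0..R} y *\<^sub>R (1 / a * (y * t * ?q y)))"
    by (rule borel_integrable_compact; use assms in \<open>auto intro!: continuous_intros\<close>)+
  let ?J = "LINT y|lborel. indicator {0..R} y *\<^sub>R (sin (y * a) / a * (y * t * ?q y))"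
  have "\<bar>?J\<bar> \<le> (LINT y|lborel. \<bar>indicator {0..R} y *\<^sub>R (sin (y * a) / a * (y * t * ?q y))\<bar>)"
    by (rule integral_abs_bound)
  also have "\<dots> \<le> (LINT y|lborel. indicator {0..R} y *\<^sub>R (1 / a * (y * t * ?q y)))"
    by (rule integral_mono[OF integrable_abs[OF i2] i3])
       (use assms in \<open>auto simp: indicator_def abs_mult intro!: divide_right_mono mult_left_le_one_le\<close>)
  also have "\<dots> = 1 / a * (?q 0 - ?q R)" unfolding c2 by (simp add: diff_divide_distrib)
  finally have J: "\<bar>?J\<bar> \<le> 1 / a * (?q 0 - ?q R)" .
  have "(LINT y|lborel. indicator {0..R} y * (cos (y * a) * ?q y)) = sin (R * a) / a * ?q R + ?J"
    using c1 Bochner_Integration.integral_diff[OF i1 i2] by (simp add: algebra_simps)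
  moreover have "\<bar>sin (R * a) / a * ?q R\<bar> \<le> 1 / a * ?q R"
    using assms by (auto simp: abs_mult intro!: divide_right_mono mult_left_le_one_le)
  ultimately have "\<bar>LINT y|lborel. indicator {0..R} y * (cos (y * a) * ?q y)\<bar> \<le> 1 / a * ?q R + 1 / a * (?q 0 - ?q R)"
    using J by linarith
  also have "\<dots> = 1 / a * ?q 0" by (simp add: algebra_simps)
  also have "\<dots> \<le> 1 / a * 1" using assms by (intro mult_left_mono) auto
  finally show ?thesis by simp
qed

lemma damped_cosine_limit:
  fixes t a b :: real
  assumes "t > 0"
  shows "((\<lambda>R. LINT y|lborel. indicator {0..R} y * (cos (y * a) * exp (- ((y\<^sup>2 / 2 + b\<^sup>2 / 2) * t))))
    \<longlongrightarrow> (LINT y|lborel. indicator {0..} y * (cos (y * a) * exp (- ((y\<^sup>2 / 2 + b\<^sup>2 / 2) * t))))) at_top"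
proof (rule integral_dominated_convergence_at_top)
  have e: "exp (- ((y\<^sup>2 / 2 + b\<^sup>2 / 2) * t)) = exp (- (b\<^sup>2 / 2 * t)) * exp (- (y\<^sup>2 / 2 * t))" for y :: real
    by (simp add: algebra_simps flip: exp_add)
  have "integrable lborel (\<lambda>y. exp (- (b\<^sup>2 / 2 * t)) * (indicator {0..} y * (cos (y * 0) * exp (- (y\<^sup>2 / 2 * t)))))"
    using gaussian_cosine_integral[OF assms, of 0]
    by (intro integrable_mult_right) (simp add: has_bochner_integral_iff)
  also have "(\<lambda>y. exp (- (b\<^sup>2 / 2 * t)) * (indicator {0..} y * (cos (y * 0) * exp (- (y\<^sup>2 / 2 * t)))))
    = (\<lambda>y. indicator {0..} y * exp (- ((y\<^sup>2 / 2 + b\<^sup>2 / 2) * t)))"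
    unfolding e by (simp add: mult_ac)
  finally show "integrable lborel (\<lambda>y. indicator {0..} y * exp (- ((y\<^sup>2 / 2 + b\<^sup>2 / 2) * t)))" .
  show "\<forall>\<^sub>F R in at_top. AE y in lborel. norm (indicator {0..R} y * (cos (y * a) * exp (- ((y\<^sup>2 / 2 + b\<^sup>2 / 2) * t))))
      \<le> indicator {0..} y * exp (- ((y\<^sup>2 / 2 + b\<^sup>2 / 2) * t))"
    by (intro always_eventually allI AE_I2) (auto simp: indicator_def abs_mult)
  show "AE y in lborel. ((\<lambda>R. indicator {0..R} y * (cos (y * a) * exp (- ((y\<^sup>2 / 2 + b\<^sup>2 / 2) * t))))
     \<longlongrightarrow> indicator {0..} y * (cos (y * a) * exp (- ((y\<^sup>2 / 2 + b\<^sup>2 / 2) * t)))) at_top"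
  proof (intro AE_I2 tendsto_eventually)
    fix y :: real
    show "\<forall>\<^sub>F R in at_top. indicator {0..R} y * (cos (y * a) * exp (- ((y\<^sup>2 / 2 + b\<^sup>2 / 2) * t)))
      = indicator {0..} y * (cos (y * a) * exp (- ((y\<^sup>2 / 2 + b\<^sup>2 / 2) * t)))"
      using eventually_ge_at_top[of y] by eventually_elim (auto simp: indicator_def)
  qed
qed auto

section \<open>From the Laplace transform to the likelihood\<close>

lemma prod_ennreal_finite_factors:
  fixes f :: "'i \<Rightarrow> ennreal"
  assumes "finite I" "(\<Prod>i\<in>I. f i) < \<infinity>" "\<And>i. i \<in> I \<Longrightarrow> f i \<noteq> 0"
  shows "\<forall>i\<in>I. f i < \<infinity>"
proof -
  have "(\<Prod>i\<in>I. f i) \<noteq> 0 \<and> ((\<Prod>i\<in>I. f i) < \<infinity> \<longrightarrow> (\<forall>i\<in>I. f i < \<infinity>))"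
    using assms(1,3) by induction (auto simp: ennreal_mult_less_top)
  then show ?thesis using assms(2) by blast
qed

lemma indicator_PiE_mult_prod:
  fixes f :: "'i \<Rightarrow> real \<Rightarrow> real"
  assumes I: "finite I"
  shows "indicator (\<Pi>\<^sub>E i\<in>I. S i) y * (\<Prod>i\<in>I. f i (y i)) = (if y \<in> extensional I then 1 else 0) * (\<Prod>i\<in>I. indicator (S i) (y i) * f i (y i))"
proof (cases "\<forall>i\<in>I. y i \<in> S i")
  case True
  then show ?thesis by (auto simp: indicator_def PiE_iff)
next
  case False
  then obtain j where "j \<in> I" "y j \<notin> S j" by auto
  then have "(\<Prod>i\<in>I. indicator (S i) (y i) * f i (y i)) = 0" using I by (intro prod_zero) (auto intro!: bexI[of _ j])
  moreover have "y \<notin> (\<Pi>\<^sub>E i\<in>I. S i)" using False by (auto simp: PiE_iff)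
  ultimately show ?thesis by simp
qed

text \<open>The setting for passing from a joint Laplace transform to the likelihood of a Normal variance-mean
  mixture: arbitrary random variances, with dependence between them encoded in the transform.\<close>

locale latent_variances = prob_space M for M :: "'w measure" +
  fixes T :: "nat \<Rightarrow> 'w \<Rightarrow> real" and \<mu> \<beta> \<Delta> :: real and n :: nat and X :: "nat \<Rightarrow> real"
  assumes T_measurable: "\<And>i. i \<in> {1..n} \<Longrightarrow> T i \<in> borel_measurable M"
    and T_nonneg: "\<And>i. i \<in> {1..n} \<Longrightarrow> AE w in M. 0 \<le> T i w"
begin

abbreviation A :: "nat \<Rightarrow> real" where "A i \<equiv> X i - \<mu> * \<Delta>"
abbreviation P :: "(nat \<Rightarrow> real) measure" where "P \<equiv> \<Pi>\<^sub>M i\<in>{1..n}. lborel"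

text \<open>The contribution of one coordinate to the integrand before taking the expectation, with the domain of
  integration built in so that products over the coordinates handle boxes and the orthant alike.\<close>

definition cos_factor :: "real set \<Rightarrow> 'w \<Rightarrow> nat \<Rightarrow> real \<Rightarrow> real" where
  "cos_factor S w i y = indicator S y * (cos (y * \<bar>A i\<bar>) * exp (- ((y\<^sup>2 / 2 + \<beta>\<^sup>2 / 2) * T i w)))"

definition cosine_integrand :: "(nat \<Rightarrow> real) \<Rightarrow> real" where
  "cosine_integrand y = joint_laplace M T n (omega \<beta> y) * (\<Prod>i=1..n. cos (y i * \<bar>A i\<bar>))"

sublocale PS: product_sigma_finite "\<lambda>_::nat. lborel :: real measure" ..
sublocale PF: finite_product_sigma_finite "\<lambda>_::nat. lborel :: real measure" "{1..n}"
  by unfold_locales simp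

lemma pair_P: "pair_sigma_finite M P"
  by (intro pair_sigma_finite.intro sigma_finite_measure_axioms PF.sigma_finite_measure_axioms)

sublocale MP: pair_sigma_finite M P by (rule pair_P)

lemma AE_T_nonneg: "AE w in M. \<forall>i\<in>{1..n}. 0 \<le> T i w"
  using T_nonneg by (subst AE_finite_all) auto

lemma integrable_exp_T: 
  assumes "\<And>i. 0 \<le> \<theta> i"
  shows "integrable M (\<lambda>w. exp (- (\<Sum>i=1..n. \<theta> i * T i w)))"
proof (rule integrable_const_bound[where B=1])
  show "AE w in M. norm (exp (- (\<Sum>i=1..n. \<theta> i * T i w))) \<le> 1"
    using AE_T_nonneg by eventually_elim (auto intro!: sum_nonneg mult_nonneg_nonneg assms)
  have "T i \<in> borel_measurable M" if "i \<in> {1..n}" for i using T_measurable that .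
  then show "(\<lambda>w. exp (- (\<Sum>i=1..n. \<theta> i * T i w))) \<in> borel_measurable M"
    by (intro measurable_compose[OF _ borel_measurable_exp] borel_measurable_uminus borel_measurable_sum borel_measurable_times) auto
qed

lemma indicator_cos_prod:
  assumes "y \<in> extensional {1..n}"
  shows "indicator (\<Pi>\<^sub>E i\<in>{1..n}. S) y * (exp (- (\<Sum>i=1..n. omega \<beta> y i * T i w)) * (\<Prod>i=1..n. cos (y i * \<bar>A i\<bar>)))
    = (\<Prod>i=1..n. cos_factor S w i (y i))"
proof -
  have "exp (- (\<Sum>i=1..n. omega \<beta> y i * T i w)) * (\<Prod>i=1..n. cos (y i * \<bar>A i\<bar>))
     = (\<Prod>i=1..n. cos (y i * \<bar>A i\<bar>) * exp (- (((y i)\<^sup>2 / 2 + \<beta>\<^sup>2 / 2) * T i w)))"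
    by (simp add: sum_negf[symmetric] exp_sum omega_def prod.distrib del: sum_negf)
  then show ?thesis
    using indicator_PiE_mult_prod[of "{1..n}" "\<lambda>_. S" y "\<lambda>i y. cos (y * \<bar>A i\<bar>) * exp (- ((y\<^sup>2 / 2 + \<beta>\<^sup>2 / 2) * T i w))"] assms
    by (simp add: cos_factor_def)
qed

lemma integrand_inner:
  assumes "y \<in> space P"
  shows "(LINT w|M. (\<Prod>i=1..n. cos_factor S w i (y i))) = indicator (\<Pi>\<^sub>E i\<in>{1..n}. S) y * cosine_integrand y"
proof -
  have y: "y \<in> extensional {1..n}" using assms by (simp add: space_PiM PiE_def)
  have "(LINT w|M. (\<Prod>i=1..n. cos_factor S w i (y i)))
    = (LINT w|M. (indicator (\<Pi>\<^sub>E i\<in>{1..n}. S) y * (\<Prod>i=1..n. cos (y i * \<bar>A i\<bar>))) * exp (- (\<Sum>i=1..n. omega \<beta> y i * T i w)))"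
    by (intro Bochner_Integration.integral_cong refl, unfold indicator_cos_prod[OF y, symmetric]) (simp only: mult_ac)
  then show ?thesis by (simp add: cosine_integrand_def joint_laplace_def)
qed

lemma cos_factor_measurable:
  assumes S: "S \<in> sets borel"
  shows "(\<lambda>(w, y). (\<Prod>i=1..n. cos_factor S w i (y i))) \<in> borel_measurable (M \<Otimes>\<^sub>M P)"
proof -
  have "(\<lambda>x. cos_factor S (fst x) i (snd x i)) \<in> borel_measurable (M \<Otimes>\<^sub>M P)" if i: "i \<in> {1..n}" for i
  proof -
    have [measurable]: "T i \<in> borel_measurable M" by (rule T_measurable[OF i])
    have [measurable]: "(\<lambda>x. snd x i) \<in> borel_measurable (M \<Otimes>\<^sub>M P)"
      using measurable_compose[OF measurable_snd measurable_component_singleton[OF i, of "\<lambda>_. lborel"]] by simp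
    note [measurable] = S
    show ?thesis unfolding cos_factor_def by measurable
  qed
  then show ?thesis unfolding case_prod_beta by (intro borel_measurable_prod) auto
qed

lemma cos_factor_measurable':
  assumes "S \<in> sets borel" "i \<in> {1..n}"
  shows "(\<lambda>(w, y). cos_factor S w i y) \<in> borel_measurable (M \<Otimes>\<^sub>M lborel)"
proof -
  have [measurable]: "T i \<in> borel_measurable M" by (rule T_measurable[OF assms(2)])
  note [measurable] = assms(1)
  show ?thesis unfolding cos_factor_def by measurable
qed

lemma cos_factor_measurable_y: "S \<in> sets borel \<Longrightarrow> cos_factor S w i \<in> borel_measurable borel"
  unfolding cos_factor_def by (intro borel_measurable_times borel_measurable_indicator) auto

lemma cosine_transform_measurable:
  assumes "S \<in> sets borel"
  shows "(\<lambda>w. \<Prod>i=1..n. LINT y|lborel. cos_factor S w i y) \<in> borel_measurable M"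
  by (intro borel_measurable_prod lborel.borel_measurable_lebesgue_integral cos_factor_measurable' assms)

lemma nn_integral_P_prod:
  assumes "\<And>i. i \<in> {1..n} \<Longrightarrow> f i \<in> borel_measurable borel"
  shows "(\<integral>\<^sup>+y. (\<Prod>i=1..n. f i (y i)) \<partial>P) = (\<Prod>i=1..n. \<integral>\<^sup>+y. f i y \<partial>lborel)"
  by (rule PS.product_nn_integral_prod) (use assms in auto)

text \<open>For a fixed sample point the integrand is a product of functions of one variable each, so after the exchange the
  multiple integral factorises.\<close>

lemma fubini_cos_factors:
  assumes S: "S \<in> sets borel"
    and fin: "(\<integral>\<^sup>+w. (\<Prod>i=1..n. \<integral>\<^sup>+y. ennreal (norm (cos_factor S w i y)) \<partial>lborel) \<partial>M) < \<infinity>"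
    and fac: "AE w in M. \<forall>i\<in>{1..n}. integrable lborel (cos_factor S w i)"
  shows "(LINT y:(\<Pi>\<^sub>E i\<in>{1..n}. S)|P. cosine_integrand y) = (LINT w|M. (\<Prod>i=1..n. LINT y|lborel. cos_factor S w i y))"
    and "integrable M (\<lambda>w. \<Prod>i=1..n. LINT y|lborel. cos_factor S w i y)"
proof -
  note [measurable] = cos_factor_measurable[OF S]
  have int: "integrable (M \<Otimes>\<^sub>M P) (\<lambda>(w, y). \<Prod>i=1..n. cos_factor S w i (y i))"
  proof (rule integrableI_bounded)
    have "(\<integral>\<^sup>+x. ennreal (norm (case x of (w, y) \<Rightarrow> \<Prod>i=1..n. cos_factor S w i (y i))) \<partial>(M \<Otimes>\<^sub>M P))
       = (\<integral>\<^sup>+w. (\<integral>\<^sup>+y. ennreal (norm (\<Prod>i=1..n. cos_factor S w i (y i))) \<partial>P) \<partial>M)"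
    proof (subst PF.nn_integral_fst[symmetric])
      show "(\<lambda>x. ennreal (norm (case x of (w, y) \<Rightarrow> \<Prod>i=1..n. cos_factor S w i (y i)))) \<in> borel_measurable (M \<Otimes>\<^sub>M P)"
        by measurable
    qed simp
    also have "\<dots> = (\<integral>\<^sup>+w. (\<integral>\<^sup>+y. (\<Prod>i=1..n. ennreal (norm (cos_factor S w i (y i)))) \<partial>P) \<partial>M)"
      by (simp add: prod_norm[symmetric] prod_ennreal abs_prod)
    also have "\<dots> = (\<integral>\<^sup>+w. (\<Prod>i=1..n. \<integral>\<^sup>+y. ennreal (norm (cos_factor S w i y)) \<partial>lborel) \<partial>M)"
    proof (intro nn_integral_cong nn_integral_P_prod)
      fix w i
      note [measurable] = cos_factor_measurable_y[OF S, of w i]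
      show "(\<lambda>y. ennreal (norm (cos_factor S w i y))) \<in> borel_measurable borel" by measurable
    qed
    finally show "(\<integral>\<^sup>+x. ennreal (norm (case x of (w, y) \<Rightarrow> \<Prod>i=1..n. cos_factor S w i (y i))) \<partial>(M \<Otimes>\<^sub>M P)) < \<infinity>"
      using fin by simp
  qed measurable
  have inner: "AE w in M. (LINT y|P. (\<Prod>i=1..n. cos_factor S w i (y i))) = (\<Prod>i=1..n. LINT y|lborel. cos_factor S w i y)"
    using fac by eventually_elim (intro PS.product_integral_prod; simp)
  have fst: "integrable M (\<lambda>w. LINT y|P. (\<Prod>i=1..n. cos_factor S w i (y i)))"
    using MP.integrable_fst'[OF int] by simp
  note m2 = cosine_transform_measurable[OF S]
  have "(LINT y:(\<Pi>\<^sub>E i\<in>{1..n}. S)|P. cosine_integrand y) = (LINT y|P. (LINT w|M. (\<Prod>i=1..n. cos_factor S w i (y i))))"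
    unfolding set_lebesgue_integral_def
    by (intro Bochner_Integration.integral_cong refl) (simp only: integrand_inner real_scaleR_def)
  also have "\<dots> = (LINT w|M. (LINT y|P. (\<Prod>i=1..n. cos_factor S w i (y i))))"
    by (rule MP.Fubini_integral[OF int])
  also have "\<dots> = (LINT w|M. (\<Prod>i=1..n. LINT y|lborel. cos_factor S w i y))"
    by (rule integral_cong_AE[OF borel_measurable_integrable[OF fst] m2 inner])
  finally show "(LINT y:(\<Pi>\<^sub>E i\<in>{1..n}. S)|P. cosine_integrand y) = (LINT w|M. (\<Prod>i=1..n. LINT y|lborel. cos_factor S w i y))" .
  show "integrable M (\<lambda>w. \<Prod>i=1..n. LINT y|lborel. cos_factor S w i y)"
    by (rule integrable_cong_AE_imp[OF fst m2]) (use inner in \<open>auto elim: eventually_mono\<close>)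
qed

lemma AE_conditional_likelihood:
  "AE w in M. conditional_likelihood \<mu> \<beta> \<Delta> T n X w
    = exp ((\<Sum>i=1..n. A i) * \<beta>) / pi ^ n * (\<Prod>i=1..n. LINT y|lborel. cos_factor {0..} w i y)"
  using AE_T_nonneg
proof eventually_elim
  fix w assume T: "\<forall>i\<in>{1..n}. 0 \<le> T i w"
  let ?N = "\<lambda>i. normal_density (\<mu> * \<Delta> + \<beta> * T i w) (sqrt (T i w)) (X i)"
  have "(\<Prod>i=1..n. LINT y|lborel. cos_factor {0..} w i y) = (\<Prod>i=1..n. pi * exp (- (A i * \<beta>)) * ?N i)"
    by (intro prod.cong refl) (use T in \<open>simp add: cos_factor_def normal_density_cosine_integral\<close>)
  also have "\<dots> = pi ^ n * exp (- ((\<Sum>i=1..n. A i) * \<beta>)) * (\<Prod>i=1..n. ?N i)"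
    by (simp only: prod.distrib prod_constant card_atLeastAtMost sum_distrib_right sum_negf[symmetric] exp_sum[OF finite_atLeastAtMost]) simp
  finally show "conditional_likelihood \<mu> \<beta> \<Delta> T n X w
    = exp ((\<Sum>i=1..n. A i) * \<beta>) / pi ^ n * (\<Prod>i=1..n. LINT y|lborel. cos_factor {0..} w i y)"
    by (simp add: conditional_likelihood_def exp_minus)
qed

lemma conditional_likelihood_measurable: "conditional_likelihood \<mu> \<beta> \<Delta> T n X \<in> borel_measurable M"
  unfolding conditional_likelihood_def
proof (intro borel_measurable_prod)
  fix i assume "i \<in> {1..n}"
  then have [measurable]: "T i \<in> borel_measurable M" by (rule T_measurable)
  show "(\<lambda>w. normal_density (\<mu> * \<Delta> + \<beta> * T i w) (sqrt (T i w)) (X i)) \<in> borel_measurable M"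
    unfolding normal_density_def by measurable
qed

lemma likelihood_eq_transform:
  assumes "integrable M (\<lambda>w. \<Prod>i=1..n. LINT y|lborel. cos_factor {0..} w i y)"
  shows "integrable M (conditional_likelihood \<mu> \<beta> \<Delta> T n X)"
    and "likelihood M \<mu> \<beta> \<Delta> T n X
      = exp ((\<Sum>i=1..n. A i) * \<beta>) / pi ^ n * (LINT w|M. (\<Prod>i=1..n. LINT y|lborel. cos_factor {0..} w i y))"
proof -
  let ?F = "\<lambda>w. exp ((\<Sum>i=1..n. A i) * \<beta>) / pi ^ n * (\<Prod>i=1..n. LINT y|lborel. cos_factor {0..} w i y)"
  have F: "integrable M ?F" using assms by (rule integrable_mult_right)
  show "integrable M (conditional_likelihood \<mu> \<beta> \<Delta> T n X)"
    by (rule integrable_cong_AE_imp[OF F conditional_likelihood_measurable])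
       (use AE_conditional_likelihood in \<open>auto elim: eventually_mono\<close>)
  have "likelihood M \<mu> \<beta> \<Delta> T n X = integral\<^sup>L M ?F"
    unfolding likelihood_def
    by (rule integral_cong_AE[OF conditional_likelihood_measurable borel_measurable_integrable[OF F] AE_conditional_likelihood])
  then show "likelihood M \<mu> \<beta> \<Delta> T n X
      = exp ((\<Sum>i=1..n. A i) * \<beta>) / pi ^ n * (LINT w|M. (\<Prod>i=1..n. LINT y|lborel. cos_factor {0..} w i y))"
    by simp
qed

definition sq_factor :: "'w \<Rightarrow> nat \<Rightarrow> real \<Rightarrow> real" where
  "sq_factor w i y = indicator {0..} y * ((cos (y * \<bar>A i\<bar>))\<^sup>2 * exp (- ((y\<^sup>2 / 2 + \<beta>\<^sup>2 / 2) * T i w)))"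

definition mass_factor :: "'w \<Rightarrow> nat \<Rightarrow> real \<Rightarrow> real" where
  "mass_factor w i y = indicator {0..} y * exp (- ((y\<^sup>2 / 2 + \<beta>\<^sup>2 / 2) * T i w))"

lemma sq_factor_nonneg: "0 \<le> sq_factor w i y"
  by (simp add: sq_factor_def)

lemma norm_cos_factor_le_mass: "norm (cos_factor {0..} w i y) \<le> mass_factor w i y"
  by (simp add: cos_factor_def mass_factor_def indicator_def abs_mult)

text \<open>Integrability of the Laplace transform itself, phrased after exchanging the integrals. By Tonelli, the
  expectation of the product of the \<open>cos\<^sup>2\<close>-weighted integrals equals the integral of \<open>L1 * \<Prod> cos\<^sup>2\<close>, which is
  at most that of \<open>L1 * \<Prod> \<bar>cos\<bar>\<close>; removing the weights costs a factor 2 per coordinate.\<close>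

lemma mass_finite:
  assumes int: "set_integrable P (\<Pi>\<^sub>E i\<in>{1..n}. {0..}) cosine_integrand"
  shows "(\<integral>\<^sup>+w. (\<Prod>i=1..n. \<integral>\<^sup>+y. ennreal (mass_factor w i y) \<partial>lborel) \<partial>M) < \<infinity>"
proof -
  let ?D = "\<Pi>\<^sub>E i\<in>{1..n}. {0::real..}"
  have sq_meas [measurable]: "(\<lambda>(w, y). \<Prod>i=1..n. ennreal (sq_factor w i (y i))) \<in> borel_measurable (M \<Otimes>\<^sub>M P)"
  proof -
    have "(\<lambda>x. ennreal (sq_factor (fst x) i (snd x i))) \<in> borel_measurable (M \<Otimes>\<^sub>M P)" if i: "i \<in> {1..n}" for i
    proof -
      have [measurable]: "T i \<in> borel_measurable M" by (rule T_measurable[OF i])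
      have [measurable]: "(\<lambda>x. snd x i) \<in> borel_measurable (M \<Otimes>\<^sub>M P)"
        using measurable_compose[OF measurable_snd measurable_component_singleton[OF i, of "\<lambda>_. lborel"]] by simp
      show ?thesis unfolding sq_factor_def by measurable
    qed
    then show ?thesis unfolding case_prod_beta by (intro borel_measurable_prod_ennreal) auto
  qed
  have inner: "(\<integral>\<^sup>+w. (\<Prod>i=1..n. ennreal (sq_factor w i (y i))) \<partial>M) \<le> ennreal (norm (indicator ?D y *\<^sub>R cosine_integrand y))"
    if y: "y \<in> space P" for y
  proof -
    let ?C = "\<Prod>i=1..n. cos (y i * \<bar>A i\<bar>)"
    let ?E = "\<lambda>w. exp (- (\<Sum>i=1..n. omega \<beta> y i * T i w))"
    have yext: "y \<in> extensional {1..n}" using y by (simp add: space_PiM PiE_def)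
    have eq: "(\<Prod>i=1..n. sq_factor w i (y i)) = indicator ?D y * ?C\<^sup>2 * ?E w" for w
    proof -
      have "(\<Prod>i=1..n. sq_factor w i (y i)) = (\<Prod>i=1..n. cos_factor {0..} w i (y i) * cos (y i * \<bar>A i\<bar>))"
        by (simp add: sq_factor_def cos_factor_def power2_eq_square mult_ac)
      also have "\<dots> = indicator ?D y * (?E w * ?C) * ?C"
        by (simp only: prod.distrib indicator_cos_prod[OF yext])
      finally show ?thesis by (simp add: power2_eq_square mult_ac)
    qed
    have om: "0 \<le> omega \<beta> y i" for i by (simp add: omega_def)
    have intE: "integrable M ?E" by (rule integrable_exp_T[OF om])
    have L1: "0 \<le> joint_laplace M T n (omega \<beta> y)"
      unfolding joint_laplace_def by (intro integral_nonneg_AE) auto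
    have "(\<integral>\<^sup>+w. (\<Prod>i=1..n. ennreal (sq_factor w i (y i))) \<partial>M) = (\<integral>\<^sup>+w. ennreal (indicator ?D y * ?C\<^sup>2 * ?E w) \<partial>M)"
      by (simp only: prod_ennreal[OF sq_factor_nonneg] eq)
    also have "\<dots> = ennreal (LINT w|M. indicator ?D y * ?C\<^sup>2 * ?E w)"
      by (rule nn_integral_eq_integral) (use intE in \<open>auto intro!: integrable_mult_right\<close>)
    also have "\<dots> = ennreal (indicator ?D y * ?C\<^sup>2 * joint_laplace M T n (omega \<beta> y))"
      by (simp add: joint_laplace_def)
    also have "\<dots> \<le> ennreal (norm (indicator ?D y *\<^sub>R cosine_integrand y))"
    proof (rule ennreal_leI)
      have "\<bar>?C\<bar> \<le> 1" unfolding abs_prod by (intro prod_le_1) auto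
      then have "?C\<^sup>2 \<le> \<bar>?C\<bar>"
        using mult_left_le_one_le[of "\<bar>?C\<bar>" "\<bar>?C\<bar>"] by (simp add: power2_eq_square abs_mult_self_eq)
      then have "?C\<^sup>2 * joint_laplace M T n (omega \<beta> y) \<le> \<bar>?C\<bar> * joint_laplace M T n (omega \<beta> y)"
        using L1 by (rule mult_right_mono)
      then show "indicator ?D y * ?C\<^sup>2 * joint_laplace M T n (omega \<beta> y) \<le> norm (indicator ?D y *\<^sub>R cosine_integrand y)"
        using L1 by (simp add: indicator_def cosine_integrand_def abs_mult mult.commute)
    qed
    finally show ?thesis .
  qed
  have "(\<integral>\<^sup>+w. (\<Prod>i=1..n. \<integral>\<^sup>+y. ennreal (mass_factor w i y) \<partial>lborel) \<partial>M)
     \<le> (\<integral>\<^sup>+w. 2 ^ n * (\<integral>\<^sup>+y. (\<Prod>i=1..n. ennreal (sq_factor w i (y i))) \<partial>P) \<partial>M)"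
  proof (rule nn_integral_mono_AE)
    show "AE w in M. (\<Prod>i=1..n. \<integral>\<^sup>+y. ennreal (mass_factor w i y) \<partial>lborel)
       \<le> 2 ^ n * (\<integral>\<^sup>+y. (\<Prod>i=1..n. ennreal (sq_factor w i (y i))) \<partial>P)"
      using AE_T_nonneg
    proof eventually_elim
      fix w assume T: "\<forall>i\<in>{1..n}. 0 \<le> T i w"
      have "(\<Prod>i=1..n. \<integral>\<^sup>+y. ennreal (mass_factor w i y) \<partial>lborel) \<le> (\<Prod>i=1..n. 2 * (\<integral>\<^sup>+y. ennreal (sq_factor w i y) \<partial>lborel))"
        unfolding mass_factor_def sq_factor_def
        by (intro prod_mono_ennreal gaussian_mass_le_cos_square) (use T in auto)
      also have "\<dots> = 2 ^ n * (\<Prod>i=1..n. \<integral>\<^sup>+y. ennreal (sq_factor w i y) \<partial>lborel)"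
        by (simp add: prod.distrib)
      also have "(\<Prod>i=1..n. \<integral>\<^sup>+y. ennreal (sq_factor w i y) \<partial>lborel) = (\<integral>\<^sup>+y. (\<Prod>i=1..n. ennreal (sq_factor w i (y i))) \<partial>P)"
        by (rule nn_integral_P_prod[symmetric]) (simp add: sq_factor_def)
      finally show "(\<Prod>i=1..n. \<integral>\<^sup>+y. ennreal (mass_factor w i y) \<partial>lborel)
       \<le> 2 ^ n * (\<integral>\<^sup>+y. (\<Prod>i=1..n. ennreal (sq_factor w i (y i))) \<partial>P)" .
    qed
  qed
  also have "\<dots> = 2 ^ n * (\<integral>\<^sup>+w. (\<integral>\<^sup>+y. (\<Prod>i=1..n. ennreal (sq_factor w i (y i))) \<partial>P) \<partial>M)"
    by (intro nn_integral_cmult PF.borel_measurable_nn_integral sq_meas)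
  also have "(\<integral>\<^sup>+w. (\<integral>\<^sup>+y. (\<Prod>i=1..n. ennreal (sq_factor w i (y i))) \<partial>P) \<partial>M)
     = (\<integral>\<^sup>+y. (\<integral>\<^sup>+w. (\<Prod>i=1..n. ennreal (sq_factor w i (y i))) \<partial>M) \<partial>P)"
    by (rule MP.Fubini'[OF sq_meas, symmetric])
  also have "2 ^ n * \<dots> \<le> 2 ^ n * (\<integral>\<^sup>+y. ennreal (norm (indicator ?D y *\<^sub>R cosine_integrand y)) \<partial>P)"
    by (intro mult_left_mono nn_integral_mono inner) auto
  also have "\<dots> < \<infinity>"
    using int by (auto simp: set_integrable_def integrable_iff_bounded ennreal_mult_less_top power_less_top_ennreal)
  finally show ?thesis .
qed

lemma mass_nonzero:
  assumes "0 \<le> T i w"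
  shows "(\<integral>\<^sup>+y. ennreal (mass_factor w i y) \<partial>lborel) \<noteq> 0"
proof -
  define c where "c = exp (- ((1 / 2 + \<beta>\<^sup>2 / 2) * T i w))"
  have "ennreal c = (\<integral>\<^sup>+y. ennreal c * indicator {0..1::real} y \<partial>lborel)"
    by (simp add: nn_integral_cmult_indicator)
  also have "\<dots> \<le> (\<integral>\<^sup>+y. ennreal (mass_factor w i y) \<partial>lborel)"
  proof (rule nn_integral_mono)
    fix y :: real
    show "ennreal c * indicator {0..1} y \<le> ennreal (mass_factor w i y)"
    proof (cases "y \<in> {0..1}")
      case True
      then have "y\<^sup>2 \<le> 1" by (simp add: power_le_one)
      then have "(y\<^sup>2 / 2 + \<beta>\<^sup>2 / 2) * T i w \<le> (1 / 2 + \<beta>\<^sup>2 / 2) * T i w"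
        using assms by (intro mult_right_mono) auto
      then show ?thesis using True by (simp add: c_def mass_factor_def ennreal_leI)
    qed simp
  qed
  finally show ?thesis using c_def by (auto simp: ennreal_le_iff2)
qed

text \<open>Finiteness of a product of nonzero extended numbers makes each factor finite, so the one-dimensional
  integrals converge absolutely for almost every sample point.\<close>

lemma integrable_representation:
  assumes int: "set_integrable P (\<Pi>\<^sub>E i\<in>{1..n}. {0..}) cosine_integrand"
  shows "integrable M (conditional_likelihood \<mu> \<beta> \<Delta> T n X)"
    and "likelihood M \<mu> \<beta> \<Delta> T n X
      = exp ((\<Sum>i=1..n. A i) * \<beta>) / pi ^ n * (LINT y:(\<Pi>\<^sub>E i\<in>{1..n}. {0..})|P. cosine_integrand y)"
proof -
  note fin = mass_finite[OF int]
  have mass_meas: "(\<lambda>w. \<Prod>i=1..n. \<integral>\<^sup>+y. ennreal (mass_factor w i y) \<partial>lborel) \<in> borel_measurable M"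
  proof (intro borel_measurable_prod_ennreal lborel.borel_measurable_nn_integral)
    fix i assume i: "i \<in> {1..n}"
    have [measurable]: "T i \<in> borel_measurable M" by (rule T_measurable[OF i])
    show "(\<lambda>(w, y). ennreal (mass_factor w i y)) \<in> borel_measurable (M \<Otimes>\<^sub>M lborel)"
      unfolding mass_factor_def by measurable
  qed
  have AE_fin: "AE w in M. (\<Prod>i=1..n. \<integral>\<^sup>+y. ennreal (mass_factor w i y) \<partial>lborel) \<noteq> \<infinity>"
    using nn_integral_PInf_AE[OF mass_meas] fin by auto
  have fac: "AE w in M. \<forall>i\<in>{1..n}. integrable lborel (cos_factor {0..} w i)"
    using AE_fin AE_T_nonneg
  proof eventually_elim
    fix w assume "(\<Prod>i=1..n. \<integral>\<^sup>+y. ennreal (mass_factor w i y) \<partial>lborel) \<noteq> \<infinity>" and T: "\<forall>i\<in>{1..n}. 0 \<le> T i w"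
    then have m: "\<forall>i\<in>{1..n}. (\<integral>\<^sup>+y. ennreal (mass_factor w i y) \<partial>lborel) < \<infinity>"
      by (intro prod_ennreal_finite_factors mass_nonzero) (auto simp: less_top)
    show "\<forall>i\<in>{1..n}. integrable lborel (cos_factor {0..} w i)"
    proof
      fix i assume "i \<in> {1..n}"
      have "(\<integral>\<^sup>+y. ennreal (norm (cos_factor {0..} w i y)) \<partial>lborel) \<le> (\<integral>\<^sup>+y. ennreal (mass_factor w i y) \<partial>lborel)"
        by (intro nn_integral_mono ennreal_leI norm_cos_factor_le_mass)
      also have "\<dots> < \<infinity>" using m \<open>i \<in> {1..n}\<close> by blast
      finally show "integrable lborel (cos_factor {0..} w i)"
        by (intro integrableI_bounded) (auto intro!: cos_factor_measurable_y)
    qed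
  qed
  have "(\<integral>\<^sup>+w. (\<Prod>i=1..n. \<integral>\<^sup>+y. ennreal (norm (cos_factor {0..} w i y)) \<partial>lborel) \<partial>M)
     \<le> (\<integral>\<^sup>+w. (\<Prod>i=1..n. \<integral>\<^sup>+y. ennreal (mass_factor w i y) \<partial>lborel) \<partial>M)"
    by (intro nn_integral_mono prod_mono_ennreal ennreal_leI norm_cos_factor_le_mass)
  also note fin
  finally have bound: "(\<integral>\<^sup>+w. (\<Prod>i=1..n. \<integral>\<^sup>+y. ennreal (norm (cos_factor {0..} w i y)) \<partial>lborel) \<partial>M) < \<infinity>" .
  note fub = fubini_cos_factors[OF _ bound fac]
  show "integrable M (conditional_likelihood \<mu> \<beta> \<Delta> T n X)"
    by (rule likelihood_eq_transform(1)[OF fub(2)]) simp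
  show "likelihood M \<mu> \<beta> \<Delta> T n X
      = exp ((\<Sum>i=1..n. A i) * \<beta>) / pi ^ n * (LINT y:(\<Pi>\<^sub>E i\<in>{1..n}. {0..})|P. cosine_integrand y)"
    using likelihood_eq_transform(2)[OF fub(2)] fub(1) by simp
qed

text \<open>On a box the integrand is bounded by 1 almost surely, so the exchange is immediate.\<close>

lemma box_integral:
  fixes R :: real
  shows "(LINT y:(\<Pi>\<^sub>E i\<in>{1..n}. {0..R})|P. cosine_integrand y) = (LINT w|M. (\<Prod>i=1..n. LINT y|lborel. cos_factor {0..R} w i y))"
proof (rule fubini_cos_factors(1))
  have "(\<integral>\<^sup>+w. (\<Prod>i=1..n. \<integral>\<^sup>+y. ennreal (norm (cos_factor {0..R} w i y)) \<partial>lborel) \<partial>M)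
     \<le> (\<integral>\<^sup>+w. (\<Prod>i=1..n. emeasure lborel {0..R}) \<partial>M)"
  proof (rule nn_integral_mono_AE)
    show "AE w in M. (\<Prod>i=1..n. \<integral>\<^sup>+y. ennreal (norm (cos_factor {0..R} w i y)) \<partial>lborel) \<le> (\<Prod>i=1..n. emeasure lborel {0..R})"
      using AE_T_nonneg
    proof eventually_elim
      fix w assume T: "\<forall>i\<in>{1..n}. 0 \<le> T i w"
      show "(\<Prod>i=1..n. \<integral>\<^sup>+y. ennreal (norm (cos_factor {0..R} w i y)) \<partial>lborel) \<le> (\<Prod>i=1..n. emeasure lborel {0..R})"
      proof (rule prod_mono_ennreal)
        fix i assume "i \<in> {1..n}"
        then have "norm (cos_factor {0..R} w i y) \<le> indicator {0..R} y" for y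
          using T by (simp add: cos_factor_def indicator_def abs_mult mult_le_one)
        then have "(\<integral>\<^sup>+y. ennreal (norm (cos_factor {0..R} w i y)) \<partial>lborel) \<le> (\<integral>\<^sup>+y. indicator {0..R} y \<partial>lborel)"
          by (intro nn_integral_mono) (metis ennreal_indicator ennreal_leI)
        then show "(\<integral>\<^sup>+y. ennreal (norm (cos_factor {0..R} w i y)) \<partial>lborel) \<le> emeasure lborel {0..R}" by simp
      qed
    qed
  qed
  also have "\<dots> < \<infinity>"
    by (simp add: emeasure_space_1 power_less_top_ennreal emeasure_lborel_cbox_finite[of 0 R, simplified])
  finally show "(\<integral>\<^sup>+w. (\<Prod>i=1..n. \<integral>\<^sup>+y. ennreal (norm (cos_factor {0..R} w i y)) \<partial>lborel) \<partial>M) < \<infinity>" .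
  have "integrable lborel (\<lambda>y. indicator {0..R} y *\<^sub>R (cos (y * \<bar>A i\<bar>) * exp (- ((y\<^sup>2 / 2 + \<beta>\<^sup>2 / 2) * T i w))))" for w i
    by (rule borel_integrable_compact) (auto intro!: continuous_intros)
  then show "AE w in M. \<forall>i\<in>{1..n}. integrable lborel (cos_factor {0..R} w i)"
    by (simp add: cos_factor_def[abs_def])
qed simp

lemma improper_representation:
  assumes pos: "\<And>i. i \<in> {1..n} \<Longrightarrow> AE w in M. 0 < T i w" and A: "\<And>i. i \<in> {1..n} \<Longrightarrow> A i \<noteq> 0"
  shows "integrable M (conditional_likelihood \<mu> \<beta> \<Delta> T n X)"
    and "((\<lambda>R. exp ((\<Sum>i=1..n. A i) * \<beta>) / pi ^ n * (LINT y:(\<Pi>\<^sub>E i\<in>{1..n}. {0..R})|P. cosine_integrand y))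
      \<longlongrightarrow> likelihood M \<mu> \<beta> \<Delta> T n X) at_top"
proof -
  let ?J = "\<lambda>S w. \<Prod>i=1..n. LINT y|lborel. cos_factor S w i y"
  let ?B = "\<lambda>_::'w. \<Prod>i=1..n. 1 / \<bar>A i\<bar>"
  have AE_pos: "AE w in M. \<forall>i\<in>{1..n}. 0 < T i w" using pos by (subst AE_finite_all) auto
  have lim: "AE w in M. ((\<lambda>R. ?J {0..R} w) \<longlongrightarrow> ?J {0..} w) at_top"
    using AE_pos by eventually_elim (auto intro!: tendsto_prod damped_cosine_limit simp: cos_factor_def)
  have "AE w in M. norm (?J {0..R} w) \<le> ?B w" for R
    using AE_T_nonneg
  proof eventually_elim
    fix w assume T: "\<forall>i\<in>{1..n}. 0 \<le> T i w"
    show "norm (?J {0..R} w) \<le> ?B w"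
      unfolding real_norm_def abs_prod
    proof (intro prod_mono conjI abs_ge_zero)
      fix i assume i: "i \<in> {1..n}"
      then show "\<bar>LINT y|lborel. cos_factor {0..R} w i y\<bar> \<le> 1 / \<bar>A i\<bar>"
        unfolding cos_factor_def using T A[OF i] by (intro damped_cosine_bound) auto
    qed
  qed
  then have bound: "\<forall>\<^sub>F R in at_top. AE w in M. norm (?J {0..R} w) \<le> ?B w"
    by simp
  have B: "integrable M ?B" by simp
  have int: "integrable M (?J {0..})"
    by (rule integrable_dominated_convergence_at_top[OF _ _ B lim bound]) (rule cosine_transform_measurable, simp)+
  have conv: "((\<lambda>R. LINT w|M. ?J {0..R} w) \<longlongrightarrow> (LINT w|M. ?J {0..} w)) at_top"
    by (rule integral_dominated_convergence_at_top[OF _ _ B lim bound]) (rule cosine_transform_measurable, simp)+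
  show "integrable M (conditional_likelihood \<mu> \<beta> \<Delta> T n X)" by (rule likelihood_eq_transform(1)[OF int])
  show "((\<lambda>R. exp ((\<Sum>i=1..n. A i) * \<beta>) / pi ^ n * (LINT y:(\<Pi>\<^sub>E i\<in>{1..n}. {0..R})|P. cosine_integrand y))
      \<longlongrightarrow> likelihood M \<mu> \<beta> \<Delta> T n X) at_top"
    unfolding box_integral likelihood_eq_transform(2)[OF int] by (intro tendsto_intros conv)
qed

end

section \<open>The likelihood representation\<close>

theorem proposition5p1:
  fixes M :: "'w measure" and Z :: "real \<Rightarrow> 'w \<Rightarrow> real" and v0 :: "'w \<Rightarrow> real"
    and \<rho> :: "real measure" and \<psi> :: "real \<Rightarrow> real"
    and lam \<Delta> \<mu> \<beta> Abar :: real and n :: nat and X A :: "nat \<Rightarrow> real"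
    and T :: "nat \<Rightarrow> 'w \<Rightarrow> real" and L1 integrand :: "(nat \<Rightarrow> real) \<Rightarrow> real"
  assumes "lam > 0" and "\<Delta> > 0" and "n \<ge> 1"
    and "subordinator M Z \<rho>" and "stationary_initial_value M Z \<rho> v0"
  defines "\<psi> \<equiv> levy_psi \<rho>"
    and "T \<equiv> actual_variance Z v0 lam \<Delta>"
    and "A \<equiv> (\<lambda>i. X i - \<mu> * \<Delta>)"
    and "Abar \<equiv> (\<Sum>i=1..n. A i) / real n"
    and "L1 \<equiv> (\<lambda>y. joint_laplace M T n (omega \<beta> y))"
    and "integrand \<equiv> (\<lambda>y. L1 y * (\<Prod>i=1..n. cos (y i * \<bar>A i\<bar>)))"
  shows
    "(\<forall>y \<in> (\<Pi>\<^sub>E i\<in>{1..n}. {0..}).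
        L1 y = L1_form \<psi> lam \<Delta> n (omega \<beta> y) \<and>
        varphi \<psi> lam (s_coef lam \<Delta> n (omega \<beta> y) 1)
          = levy_exponent M v0 (s_coef lam \<Delta> n (omega \<beta> y) 1 / lam))
     \<and>
     (set_integrable (\<Pi>\<^sub>M i\<in>{1..n}. lborel) (\<Pi>\<^sub>E i\<in>{1..n}. {0..}) integrand \<longrightarrow>
        integrable M (conditional_likelihood \<mu> \<beta> \<Delta> T n X) \<and>
        likelihood M \<mu> \<beta> \<Delta> T n X =
          exp (real n * Abar * \<beta>) / pi ^ n *
          (LINT y:(\<Pi>\<^sub>E i\<in>{1..n}. {0..})|(\<Pi>\<^sub>M i\<in>{1..n}. lborel). integrand y))
     \<and>
     (emeasure \<rho> {0<..} \<noteq> 0 \<and> (\<forall>i\<in>{1..n}. A i \<noteq> 0) \<longrightarrow>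
        integrable M (conditional_likelihood \<mu> \<beta> \<Delta> T n X) \<and>
        ((\<lambda>R. exp (real n * Abar * \<beta>) / pi ^ n *
           (LINT y:(\<Pi>\<^sub>E i\<in>{1..n}. {0..R})|(\<Pi>\<^sub>M i\<in>{1..n}. lborel). integrand y))
          \<longlongrightarrow> likelihood M \<mu> \<beta> \<Delta> T n X) at_top)"
proof -
  interpret stationary_subordinator_model M Z \<rho> v0
    using assms(4,5) by unfold_locales
  interpret L: latent_variances M T \<mu> \<beta> \<Delta> n X
    unfolding T_def
    by unfold_locales (use assms(1,2) in \<open>auto intro: actual_variance_measurable actual_variance_nonneg\<close>)
  have om: "0 \<le> omega \<beta> y i" for y i by (simp add: omega_def)
  have integrand: "integrand = L.cosine_integrand"
    by (simp add: fun_eq_iff integrand_def L1_def A_def L.cosine_integrand_def)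
  have Abar: "real n * Abar * \<beta> = (\<Sum>i=1..n. X i - \<mu> * \<Delta>) * \<beta>"
    using \<open>n \<ge> 1\<close> by (simp add: Abar_def A_def)
  show ?thesis
  proof (intro conjI ballI impI)
    fix y :: "nat \<Rightarrow> real"
    show "L1 y = L1_form \<psi> lam \<Delta> n (omega \<beta> y)"
      unfolding L1_def T_def \<psi>_def
      by (rule joint_laplace_actual_variances(1)[OF assms(1-3) om])
    show "varphi \<psi> lam (s_coef lam \<Delta> n (omega \<beta> y) 1)
        = levy_exponent M v0 (s_coef lam \<Delta> n (omega \<beta> y) 1 / lam)"
      unfolding \<psi>_def by (rule joint_laplace_actual_variances(2)[OF assms(1-3) om])
  next
    assume int: "set_integrable (\<Pi>\<^sub>M i\<in>{1..n}. lborel) (\<Pi>\<^sub>E i\<in>{1..n}. {0..}) integrand"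
    note rep = L.integrable_representation[OF int[unfolded integrand]]
    show "integrable M (conditional_likelihood \<mu> \<beta> \<Delta> T n X)" by (rule rep(1))
    show "likelihood M \<mu> \<beta> \<Delta> T n X = exp (real n * Abar * \<beta>) / pi ^ n *
          (LINT y:(\<Pi>\<^sub>E i\<in>{1..n}. {0..})|(\<Pi>\<^sub>M i\<in>{1..n}. lborel). integrand y)"
      unfolding Abar integrand by (rule rep(2))
  next
    assume H: "emeasure \<rho> {0<..} \<noteq> 0 \<and> (\<forall>i\<in>{1..n}. A i \<noteq> 0)"
    have pos: "AE w in M. 0 < T i w" if "i \<in> {1..n}" for i
      unfolding T_def using assms(1,2) H that by (intro actual_variance_pos) auto
    have A: "X i - \<mu> * \<Delta> \<noteq> 0" if "i \<in> {1..n}" for i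
      using H that by (simp add: A_def)
    note rep = L.improper_representation[OF pos A]
    show "integrable M (conditional_likelihood \<mu> \<beta> \<Delta> T n X)" by (rule rep(1))
    show "((\<lambda>R. exp (real n * Abar * \<beta>) / pi ^ n *
           (LINT y:(\<Pi>\<^sub>E i\<in>{1..n}. {0..R})|(\<Pi>\<^sub>M i\<in>{1..n}. lborel). integrand y))
          \<longlongrightarrow> likelihood M \<mu> \<beta> \<Delta> T n X) at_top"
      unfolding Abar integrand by (rule rep(2))
  qed
qed

end
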